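(* For every $n\ge 1$ there is a constant $c_n>0$ depending only on $n$ such that, for every weight $w$ in $\mathbb{R}^n$, every $\frac12\le\delta<1$, every cube $Q$ in $\mathbb{R}^n$ and every $u\in L^1_{\mathrm{loc}}(\mathbb{R}^n)$, $$\inf_{c\in\mathbb{R}}\left(\int_Q|u(x)-c|^{\frac{n}{n-\delta}}\,w(x)\,dx\right)^{\frac{n-\delta}{n}}\le c_n\,(1-\delta)\int_Q\int_Q\frac{|u(x)-u(y)|}{|x-y|^{n+\delta}}\,dy\,\big(Mw(x)\big)^{\frac{n-\delta}{n}}\,dx.$$
   Context: A cube in $\mathbb{R}^n$ is a cartesian product of $n$ intervals of the same side length. A weight is a function $w\in L^1_{\mathrm{loc}}(\mathbb{R}^n)$ with $w(x)>0$ for a.e. $x$. $M$ is the non-centered Hardy–Littlewood maximal function $Mf(x)=\sup_{R\ni x}\frac1{|R|}\int_R|f|\,dy$, the supremum over all cubes $R$ in $\mathbb{R}^n$ containing $x$. *)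

theory Defs
  imports "HOL-Analysis.Analysis"
begin

text \<open>An interval with end points \<open>a\<close> and \<open>a + l\<close> may contain any of its end points;
  cubes are nondegenerate and bounded.\<close>

definition is_cube :: "(real ^ 'n) set \<Rightarrow> bool" where
  "is_cube Q \<longleftrightarrow>
     (\<exists>l>0. \<exists>(a :: 'n \<Rightarrow> real) I.
        (\<forall>i. {a i <..< a i + l} \<subseteq> I i \<and> I i \<subseteq> {a i .. a i + l}) \<and>
        Q = {x. \<forall>i. x $ i \<in> I i})"

definition locally_integrable :: "(real ^ 'n \<Rightarrow> real) \<Rightarrow> bool" where
  "locally_integrable f \<longleftrightarrow> (\<forall>K. compact K \<longrightarrow> f absolutely_integrable_on K)"

definition weight :: "(real ^ 'n \<Rightarrow> real) \<Rightarrow> bool" where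
  "weight w \<longleftrightarrow> locally_integrable w \<and> (AE x in lebesgue. w x > 0)"

definition maximal_function :: "(real ^ 'n \<Rightarrow> real) \<Rightarrow> real ^ 'n \<Rightarrow> ennreal" where
  "maximal_function f x =
     (SUP R \<in> {R. is_cube R \<and> x \<in> R}.
        (\<integral>\<^sup>+ y\<in>R. ennreal \<bar>f y\<bar> \<partial>lebesgue) / emeasure lebesgue R)"

text \<open>The power \<open>x\<^sup>p\<close> for \<open>x \<in> [0, \<infinity>]\<close>, meant for exponents \<open>p > 0\<close> only: \<open>\<infinity>\<^sup>p = \<infinity>\<close>.\<close>

definition ennreal_powr :: "ennreal \<Rightarrow> real \<Rightarrow> ennreal" where
  "ennreal_powr x p = (if x = \<infinity> then \<infinity> else ennreal (enn2real x powr p))"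

end

theory Submission
  imports Defs
begin

text \<open>Write \<open>n\<close> for the dimension, \<open>p = n / (n - \<delta>)\<close>, \<open>W\<close> for the measure with density \<open>w\<close>, and
  \<open>g\<^sub>u x\<close> for the inner integral \<open>\<integral>\<^sub>Q \<bar>u x - u y\<bar> / \<bar>x - y\<bar>\<^sup>n\<^sup>+\<^sup>\<delta> dy\<close> (\<open>kernel_energy\<close> below).

  For indicator functions the inequality is isoperimetric: if \<open>E\<close> fills at most half of \<open>Q\<close>, then
  \<open>W (E \<inter> Q)\<close> to the power \<open>1 / p\<close> is at most \<open>c (1 - \<delta>)\<close> times the integral over \<open>Q\<close> of
  \<open>g\<close>, taken for the indicator function of \<open>E\<close>, against \<open>Mw\<close> to the power \<open>1 / p\<close>
  (lemma \<open>weighted_isoperimetric\<close>).  Its proof is a stopping time argument.  The dyadic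
  subcubes of \<open>Q\<close> containing a given point of \<open>E\<close> start with \<open>Q\<close>, which is at most half full of
  \<open>E\<close>, and, at almost every point, later become more than half full; just before that happens
  there is a cube \<open>P\<close> in which \<open>E\<close> and its complement both take up a fixed proportion.  Choosing
  the first such cube at each point gives disjoint cubes that cover \<open>E\<close> up to a null set.  On
  each of them the unweighted fractional Poincare inequality with the factor \<open>1 - \<delta>\<close> shows that
  \<open>\<bar>P\<bar>\<close> to the power \<open>1 / p\<close> is bounded by the energy inside \<open>P\<close>.  As \<open>W P / \<bar>P\<bar> \<le> Mw\<close> on \<open>P\<close>, the
  weight can be moved under the integral, and as \<open>1 / p \<le> 1\<close>, the contributions of the cubes can
  be added.

  The Poincare inequality (\<open>fractional_poincare\<close>) comes from cutting the segment from \<open>x\<close> to \<open>y\<close>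
  into \<open>2\<^sup>k\<close> equal pieces.  This bounds the double integral of \<open>\<bar>u x - u y\<bar>\<close> by its part at
  distance of order \<open>2\<^sup>-\<^sup>k\<close>, for every \<open>k\<close>; a weighted sum over all \<open>k\<close> recovers the fractional
  kernel, and the total mass of the weights is at least \<open>1 / (1 - \<delta>)\<close>.

  A general \<open>u\<close> is handled through its level sets.  Subtract a median \<open>m\<close> of \<open>u\<close> on \<open>Q\<close>; then the
  sets \<open>{u - m > t}\<close> and \<open>{m - u > t}\<close> with \<open>t > 0\<close> fill at most half of \<open>Q\<close>.  The energy \<open>g\<close> is
  additive over level sets (\<open>kernel_energy_coarea\<close>), while the norm of the positive part of
  \<open>u - m\<close> in \<open>L\<^sup>p(W)\<close> is bounded by a constant times the integral over \<open>t > 0\<close> of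
  \<open>W {u - m > t}\<close> to the power \<open>1 / p\<close> (\<open>layer_cake_bound\<close>).  All constants stay bounded as
  \<open>\<delta>\<close> tends to \<open>1\<close>, also in dimension one, where \<open>p\<close> tends to infinity.\<close>

section \<open>Powers of extended nonnegative reals\<close>

lemma ennreal_powr_ennreal: "0 \<le> a \<Longrightarrow> ennreal_powr (ennreal a) p = ennreal (a powr p)"
  by (simp add: ennreal_powr_def)

lemma ennreal_powr_top [simp]: "ennreal_powr top p = top"
  by (simp add: ennreal_powr_def)

lemma ennreal_powr_mono:
  assumes "x \<le> y" "0 < p"
  shows "ennreal_powr x p \<le> ennreal_powr y p"
  using assms
  by (cases x rule: ennreal_cases; cases y rule: ennreal_cases)
     (auto simp: ennreal_powr_ennreal intro!: ennreal_leI powr_mono2 simp: top_unique)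

lemma ennreal_powr_mult:
  assumes "0 < p"
  shows "ennreal_powr (x * y) p = ennreal_powr x p * ennreal_powr y p"
proof (cases x rule: ennreal_cases)
  case (real a)
  show ?thesis
  proof (cases y rule: ennreal_cases)
    case (real b)
    with \<open>x = ennreal a\<close> \<open>0 \<le> a\<close> show ?thesis
      by (simp add: ennreal_powr_ennreal ennreal_mult[symmetric] powr_mult)
  next
    case top
    with \<open>x = ennreal a\<close> \<open>0 \<le> a\<close> show ?thesis
      by (cases "a = 0") (auto simp: ennreal_powr_ennreal ennreal_mult_top ennreal_powr_def)
  qed
next
  case top
  then show ?thesis
    using assms by (cases y rule: ennreal_cases) (auto simp: ennreal_top_mult ennreal_powr_def)
qed

lemma ennreal_powr_add: "ennreal_powr x (p + q) = ennreal_powr x p * ennreal_powr x q"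
  by (cases x rule: ennreal_cases)
     (simp_all add: ennreal_powr_ennreal powr_add ennreal_mult[symmetric])

lemma ennreal_powr_one: "ennreal_powr x 1 = x"
  by (cases x rule: ennreal_cases) (simp_all add: ennreal_powr_ennreal)

lemma ennreal_powr_powr: "ennreal_powr (ennreal_powr x p) q = ennreal_powr x (p * q)"
  by (cases x rule: ennreal_cases) (simp_all add: ennreal_powr_ennreal powr_powr)

lemma measurable_ennreal_powr [measurable]:
  assumes [measurable]: "f \<in> borel_measurable M"
  shows "(\<lambda>x. ennreal_powr (f x) p) \<in> borel_measurable M"
  unfolding ennreal_powr_def by measurable

text \<open>Countable subadditivity of a concave power.  With \<open>S\<close> the sum of the \<open>a\<^sub>i\<^sup>s\<close>, every
  \<open>a\<^sub>i = a\<^sub>i\<^sup>s (a\<^sub>i\<^sup>s)\<^sup>q\<close>, where \<open>q = 1 / s - 1\<close>, is at most \<open>a\<^sub>i\<^sup>s S\<^sup>q\<close>; summation bounds the sum of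
  the \<open>a\<^sub>i\<close> by \<open>S\<close> to the power \<open>1 + q = 1 / s\<close>.\<close>

lemma ennreal_powr_nn_integral_count_space_le:
  assumes "0 < s" "s < 1"
  shows "ennreal_powr (\<integral>\<^sup>+ i. a i \<partial>count_space I) s \<le> (\<integral>\<^sup>+ i. ennreal_powr (a i) s \<partial>count_space I)"
    (is "_ \<le> ?S")
proof -
  define q where "q = 1 / s - 1"
  have "0 < q" and sq: "s * (1 + q) = 1" "(1 + q) * s = 1"
    using assms by (auto simp: q_def field_simps)
  have "a i \<le> ennreal_powr (a i) s * ennreal_powr ?S q" if "i \<in> I" for i
  proof -
    have "a i = ennreal_powr (ennreal_powr (a i) s) (1 + q)"
      by (simp add: ennreal_powr_powr sq ennreal_powr_one)
    also have "\<dots> = ennreal_powr (a i) s * ennreal_powr (ennreal_powr (a i) s) q"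
      using ennreal_powr_add[of _ 1 q] by (simp add: ennreal_powr_one)
    also have "\<dots> \<le> ennreal_powr (a i) s * ennreal_powr ?S q"
      by (intro mult_left_mono ennreal_powr_mono nn_integral_ge_point that \<open>0 < q\<close>) simp
    finally show ?thesis .
  qed
  then have "(\<integral>\<^sup>+ i. a i \<partial>count_space I)
      \<le> (\<integral>\<^sup>+ i. ennreal_powr (a i) s * ennreal_powr ?S q \<partial>count_space I)"
    by (intro nn_integral_mono) simp
  also have "\<dots> = ?S * ennreal_powr ?S q"
    by (simp add: nn_integral_multc)
  also have "\<dots> = ennreal_powr ?S (1 + q)"
    using ennreal_powr_add[of _ 1 q] by (simp add: ennreal_powr_one)
  finally have "ennreal_powr (\<integral>\<^sup>+ i. a i \<partial>count_space I) s \<le> ennreal_powr (ennreal_powr ?S (1 + q)) s"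
    using assms by (intro ennreal_powr_mono)
  then show ?thesis
    by (simp add: ennreal_powr_powr sq ennreal_powr_one)
qed

section \<open>The fractional Poincare inequality on convex sets\<close>

lemma nn_integral_lborel_affine:
  fixes t :: "'a::euclidean_space"
  assumes [measurable]: "f \<in> borel_measurable borel" and "0 < c"
  shows "(\<integral>\<^sup>+ x. f x \<partial>lborel) = ennreal (c ^ DIM('a)) * (\<integral>\<^sup>+ x. f (t + c *\<^sub>R x) \<partial>lborel)"
  using assms(2)
  by (subst lborel_affine[of c t])
     (simp_all add: nn_integral_density nn_integral_distr nn_integral_cmult)

lemma nn_integral_lborel_translate:
  fixes t :: "'a::euclidean_space"
  assumes [measurable]: "f \<in> borel_measurable borel"
  shows "(\<integral>\<^sup>+ x. f (x + t) \<partial>lborel) = (\<integral>\<^sup>+ x. f x \<partial>lborel)"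
  using nn_integral_lborel_affine[of f 1 t] by (simp add: add.commute)

lemma nn_integral_lborel_swap:
  fixes f :: "'a::euclidean_space \<Rightarrow> 'b::euclidean_space \<Rightarrow> ennreal"
  assumes "case_prod f \<in> borel_measurable borel"
  shows "(\<integral>\<^sup>+ x. \<integral>\<^sup>+ y. f x y \<partial>lborel \<partial>lborel) = (\<integral>\<^sup>+ y. \<integral>\<^sup>+ x. f x y \<partial>lborel \<partial>lborel)"
  using assms by (intro lborel_pair.Fubini'[symmetric]) (simp add: lborel_prod)

lemma set_nn_integral_double:
  assumes [measurable]: "\<And>x. F x \<in> borel_measurable M" "P \<in> sets M"
  shows "(\<integral>\<^sup>+ x\<in>P. (\<integral>\<^sup>+ y\<in>P. F x y \<partial>M) \<partial>M)
    = (\<integral>\<^sup>+ x. \<integral>\<^sup>+ y. F x y * indicator P x * indicator P y \<partial>M \<partial>M)"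
proof (rule nn_integral_cong)
  fix x
  show "(\<integral>\<^sup>+ y\<in>P. F x y \<partial>M) * indicator P x = (\<integral>\<^sup>+ y. F x y * indicator P x * indicator P y \<partial>M)"
    by (subst nn_integral_multc[symmetric]) (auto intro!: nn_integral_cong simp: indicator_def)
qed

lemma convex_ray_point:
  fixes z h :: "'a::real_vector"
  assumes "convex P" "z \<in> P" "z + real N *\<^sub>R h \<in> P" "j \<le> N"
  shows "z + real j *\<^sub>R h \<in> P"
proof (cases "N = 0")
  case False
  have "(1 - j / N) *\<^sub>R z + (j / N) *\<^sub>R (z + real N *\<^sub>R h) \<in> P"
    using assms False by (intro convexD) auto
  moreover have "(1 - j / N) *\<^sub>R z + (j / N) *\<^sub>R (z + real N *\<^sub>R h) = z + real j *\<^sub>R h"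
    using False by (simp add: algebra_simps)
  ultimately show ?thesis by simp
qed (use assms in auto)

text \<open>The difference \<open>f x - f y\<close> telescopes along the \<open>N\<close> steps \<open>h = (y - x) / N\<close>, which have length at
  most \<open>d / N\<close>.  The substitution \<open>y = x + N h\<close> costs the factor \<open>N\<^sup>n\<close>, where \<open>n\<close> is the
  dimension; for fixed \<open>h\<close>, a translation turns each of the \<open>N\<close> summands into the same integral,
  whose points stay in \<open>P\<close> by convexity.\<close>

lemma double_integral_le_short_range:
  fixes f :: "'a::euclidean_space \<Rightarrow> real"
  assumes [measurable]: "f \<in> borel_measurable borel" "P \<in> sets borel"
    and P: "convex P" and d: "\<And>x y. x \<in> P \<Longrightarrow> y \<in> P \<Longrightarrow> norm (x - y) \<le> d" and N: "0 < N"
  shows "(\<integral>\<^sup>+ x\<in>P. (\<integral>\<^sup>+ y\<in>P. ennreal \<bar>f x - f y\<bar> \<partial>lborel) \<partial>lborel)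
    \<le> ennreal (real N ^ (DIM('a) + 1)) *
      (\<integral>\<^sup>+ x\<in>P. (\<integral>\<^sup>+ y\<in>P. ennreal \<bar>f x - f y\<bar> * indicator {..d / N} (norm (x - y)) \<partial>lborel) \<partial>lborel)"
proof -
  let ?n = "DIM('a)"
  define i where "i z = (indicator P z :: ennreal)" for z
  have [measurable]: "i \<in> borel_measurable borel"
    unfolding i_def by measurable
  define G where "G z h = ennreal \<bar>f z - f (z + h)\<bar> * indicator {..d / N} (norm h) * i z * i (z + h)" for z h
  have [measurable]: "case_prod G \<in> borel_measurable (borel \<Otimes>\<^sub>M borel)"
    unfolding G_def by measurable
  have [measurable]: "case_prod G \<in> borel_measurable borel"
    unfolding borel_prod[symmetric] by measurable
  have shift: "(\<integral>\<^sup>+ x. \<integral>\<^sup>+ h. G x h \<partial>lborel \<partial>lborel)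
    = (\<integral>\<^sup>+ x. \<integral>\<^sup>+ y. ennreal \<bar>f x - f y\<bar> * indicator {..d / N} (norm (x - y)) * i x * i y \<partial>lborel \<partial>lborel)"
  proof (rule nn_integral_cong)
    fix x
    show "(\<integral>\<^sup>+ h. G x h \<partial>lborel)
       = (\<integral>\<^sup>+ y. ennreal \<bar>f x - f y\<bar> * indicator {..d / N} (norm (x - y)) * i x * i y \<partial>lborel)"
      using nn_integral_lborel_affine[of "\<lambda>y. ennreal \<bar>f x - f y\<bar> * indicator {..d / N} (norm (x - y)) * i x * i y" 1 x]
      by (simp add: G_def)
  qed
  have "(\<integral>\<^sup>+ x\<in>P. (\<integral>\<^sup>+ y\<in>P. ennreal \<bar>f x - f y\<bar> \<partial>lborel) \<partial>lborel)
      = (\<integral>\<^sup>+ x. \<integral>\<^sup>+ y. ennreal \<bar>f x - f y\<bar> * i x * i y \<partial>lborel \<partial>lborel)"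
    by (simp add: i_def set_nn_integral_double)
  also have "\<dots> = (\<integral>\<^sup>+ x. ennreal (real N ^ ?n) *
        (\<integral>\<^sup>+ h. ennreal \<bar>f x - f (x + real N *\<^sub>R h)\<bar> * i x * i (x + real N *\<^sub>R h) \<partial>lborel) \<partial>lborel)"
  proof (rule nn_integral_cong)
    fix x
    show "(\<integral>\<^sup>+ y. ennreal \<bar>f x - f y\<bar> * i x * i y \<partial>lborel) = ennreal (real N ^ ?n) *
        (\<integral>\<^sup>+ h. ennreal \<bar>f x - f (x + real N *\<^sub>R h)\<bar> * i x * i (x + real N *\<^sub>R h) \<partial>lborel)"
      using N by (subst nn_integral_lborel_affine[of _ "real N" x]) auto
  qed
  also have "\<dots> \<le> (\<integral>\<^sup>+ x. ennreal (real N ^ ?n) * (\<integral>\<^sup>+ h. (\<Sum>j<N. G (x + real j *\<^sub>R h) h) \<partial>lborel) \<partial>lborel)"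
  proof (intro nn_integral_mono mult_left_mono)
    fix x h :: 'a
    show "ennreal \<bar>f x - f (x + real N *\<^sub>R h)\<bar> * i x * i (x + real N *\<^sub>R h) \<le> (\<Sum>j<N. G (x + real j *\<^sub>R h) h)"
    proof (cases "x \<in> P \<and> x + real N *\<^sub>R h \<in> P")
      case True
      have mem: "x + real j *\<^sub>R h \<in> P" if "j \<le> N" for j
        using True that P convex_ray_point by blast
      have "real N * norm h \<le> d"
        using d[of "x + real N *\<^sub>R h" x] True by simp
      then have h: "norm h \<le> d / N"
        using N by (simp add: field_simps)
      have G: "G (x + real j *\<^sub>R h) h = ennreal \<bar>f (x + real j *\<^sub>R h) - f (x + real (Suc j) *\<^sub>R h)\<bar>" if "j < N" for j
        using mem[of j] mem[of "Suc j"] that h by (simp add: G_def i_def algebra_simps)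
      have "f x - f (x + real N *\<^sub>R h) = (\<Sum>j<N. f (x + real j *\<^sub>R h) - f (x + real (Suc j) *\<^sub>R h))"
        by (subst sum_lessThan_telescope') simp
      then have "\<bar>f x - f (x + real N *\<^sub>R h)\<bar> \<le> (\<Sum>j<N. \<bar>f (x + real j *\<^sub>R h) - f (x + real (Suc j) *\<^sub>R h)\<bar>)"
        by (simp only: sum_abs)
      then show ?thesis
        using True G by (simp add: i_def sum_ennreal ennreal_leI)
    qed (auto simp: i_def)
  qed simp
  also have "\<dots> = ennreal (real N ^ ?n) * (\<Sum>j<N. \<integral>\<^sup>+ x. \<integral>\<^sup>+ h. G (x + real j *\<^sub>R h) h \<partial>lborel \<partial>lborel)"
    by (simp add: nn_integral_cmult nn_integral_sum)
  also have "\<dots> = ennreal (real N ^ ?n) * (\<Sum>j<N. \<integral>\<^sup>+ h. \<integral>\<^sup>+ x. G (x + real j *\<^sub>R h) h \<partial>lborel \<partial>lborel)"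
    by (intro arg_cong2[where f="(*)"] refl sum.cong nn_integral_lborel_swap)
       (simp add: borel_prod[symmetric])
  also have "\<dots> = ennreal (real N ^ ?n) * (\<Sum>j<N. \<integral>\<^sup>+ h. \<integral>\<^sup>+ x. G x h \<partial>lborel \<partial>lborel)"
    by (simp add: nn_integral_lborel_translate[of "\<lambda>x. G x _"])
  also have "\<dots> = ennreal (real N ^ ?n) * (\<Sum>j<N. \<integral>\<^sup>+ x. \<integral>\<^sup>+ h. G x h \<partial>lborel \<partial>lborel)"
    by (intro arg_cong2[where f="(*)"] refl sum.cong nn_integral_lborel_swap[symmetric]) simp
  also have "\<dots> = ennreal (real N ^ (?n + 1)) * (\<integral>\<^sup>+ x. \<integral>\<^sup>+ h. G x h \<partial>lborel \<partial>lborel)"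
    by (simp add: ennreal_mult[symmetric] mult.assoc[symmetric] ennreal_of_nat_eq_real_of_nat mult.commute)
  also have "\<dots> = ennreal (real N ^ (DIM('a) + 1)) *
      (\<integral>\<^sup>+ x\<in>P. (\<integral>\<^sup>+ y\<in>P. ennreal \<bar>f x - f y\<bar> * indicator {..d / N} (norm (x - y)) \<partial>lborel) \<partial>lborel)"
    unfolding shift by (simp add: i_def set_nn_integral_double)
  finally show ?thesis .
qed

text \<open>As \<open>2\<close> to the power \<open>b\<close> is at least \<open>2\<close>, the geometric sum is at most twice its last term.\<close>

lemma dyadic_sum_le:
  fixes b R :: real
  assumes "1 \<le> b"
  shows "(\<Sum>k<K. if 2 ^ k \<le> R then (2 ^ k) powr b else 0) \<le> 2 * R powr b"
proof (induction K)
  case (Suc K)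
  have two: "2 \<le> (2::real) powr b"
    using powr_mono[of 1 b "2::real"] assms by simp
  have geo: "(\<Sum>k<Suc J. (2 ^ k) powr b) \<le> 2 * (2 ^ J) powr b" for J
  proof (induction J)
    case (Suc J)
    have "(2 ^ Suc J) powr b = 2 powr b * (2 ^ J) powr b"
      by (simp add: powr_mult)
    moreover have "2 * (2 ^ J) powr b \<le> 2 powr b * (2 ^ J) powr b"
      using two by (intro mult_right_mono) auto
    ultimately show ?case
      using Suc unfolding sum.lessThan_Suc[of _ "Suc J"] by linarith
  qed simp
  show ?case
  proof (cases "2 ^ K \<le> R")
    case True
    have "(\<Sum>k<Suc K. if 2 ^ k \<le> R then (2 ^ k) powr b else 0) \<le> (\<Sum>k<Suc K. (2 ^ k) powr b)"
      by (intro sum_mono) auto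
    also have "\<dots> \<le> 2 * (2 ^ K) powr b"
      by (rule geo)
    also have "\<dots> \<le> 2 * R powr b"
      using True assms by (intro mult_left_mono powr_mono2) auto
    finally show ?thesis .
  qed (use Suc in simp)
qed simp

text \<open>Apply the preceding estimate with \<open>N = 2\<^sup>k\<close>, multiply by \<open>q\<^sup>k\<close> where \<open>q\<close> is \<open>2\<close> to the power
  \<open>\<delta> - 1\<close>, and sum over \<open>k\<close>.  On the right, \<open>q\<^sup>k N\<^sup>n\<^sup>+\<^sup>1\<close> is \<open>2\<^sup>k\<close> to the power \<open>n + \<delta>\<close>, and only the \<open>k\<close> with
  \<open>2\<^sup>k \<le> d / \<bar>x - y\<bar>\<close> contribute, so the sum is comparable to the fractional kernel.  On the left
  the geometric series produces \<open>1 / (1 - q)\<close>, which is where the factor \<open>1 - \<delta>\<close> comes from.\<close>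

lemma fractional_poincare:
  fixes f :: "'a::euclidean_space \<Rightarrow> real" and \<delta> :: real
  assumes [measurable]: "f \<in> borel_measurable borel" "P \<in> sets borel"
    and P: "convex P" and d: "\<And>x y. x \<in> P \<Longrightarrow> y \<in> P \<Longrightarrow> norm (x - y) \<le> d" and d0: "0 < d"
    and \<delta>: "0 < \<delta>" "\<delta> < 1"
  shows "(\<integral>\<^sup>+ x\<in>P. (\<integral>\<^sup>+ y\<in>P. ennreal \<bar>f x - f y\<bar> \<partial>lborel) \<partial>lborel)
    \<le> ennreal ((1 - \<delta>) * (2 * d powr (DIM('a) + \<delta>))) *
      (\<integral>\<^sup>+ x\<in>P. (\<integral>\<^sup>+ y\<in>P. ennreal (\<bar>f x - f y\<bar> / norm (x - y) powr (DIM('a) + \<delta>)) \<partial>lborel) \<partial>lborel)"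
    (is "?A \<le> _ * ?B")
proof -
  define b where "b = DIM('a) + \<delta>"
  define q where "q = 2 powr - (1 - \<delta>)"
  define i where "i z = (indicator P z :: ennreal)" for z
  have [measurable]: "i \<in> borel_measurable borel"
    unfolding i_def by measurable
  have b: "1 \<le> b"
    using \<delta> DIM_positive[where 'a='a] unfolding b_def by linarith
  have q: "0 < q" "q < 1"
    using \<delta> powr_less_mono[of "- (1 - \<delta>)" 0 "2::real"] by (auto simp: q_def)
  \<comment> \<open>Convexity of the exponential function, together with \<open>ln 2 \<le> 1\<close>.\<close>
  have "1 - q \<le> 1 - \<delta>"
  proof -
    have "q = exp (- (1 - \<delta>) * ln 2)"
      by (simp add: q_def powr_def)
    then have "1 - q \<le> (1 - \<delta>) * ln 2"
      using exp_ge_add_one_self[of "- (1 - \<delta>) * ln 2"] by linarith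
    also have "\<dots> \<le> (1 - \<delta>) * 1"
      using \<delta> ln_2_less_1 by (intro mult_left_mono) auto
    finally show ?thesis by simp
  qed
  define g where "g k x y = ennreal \<bar>f x - f y\<bar> *
      (ennreal ((2 ^ k) powr b) * indicator {..d / 2 ^ k} (norm (x - y))) * i x * i y" for k x y
  have [measurable]: "case_prod (g k) \<in> borel_measurable (borel \<Otimes>\<^sub>M borel)" for k
    unfolding g_def by measurable
  have scale: "ennreal (q ^ k) * ?A \<le> (\<integral>\<^sup>+ x. \<integral>\<^sup>+ y. g k x y \<partial>lborel \<partial>lborel)" for k
  proof -
    have pw: "q ^ k * (2 ^ k) ^ (DIM('a) + 1) = (2 ^ k) powr b"
    proof -
      have "q ^ k = (2 ^ k) powr - (1 - \<delta>)"
        using powr_realpow[of q k] powr_realpow[of 2 k, symmetric] q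
        by (simp add: q_def powr_powr mult.commute)
      moreover have "(2 ^ k) ^ (DIM('a) + 1) = (2 ^ k :: real) powr real (DIM('a) + 1)"
        by (subst powr_realpow) auto
      ultimately show ?thesis
        by (simp add: powr_add[symmetric] b_def algebra_simps)
    qed
    have "ennreal (q ^ k) * ?A \<le> ennreal (q ^ k) * (ennreal (real (2 ^ k) ^ (DIM('a) + 1)) *
      (\<integral>\<^sup>+ x\<in>P. (\<integral>\<^sup>+ y\<in>P. ennreal \<bar>f x - f y\<bar> * indicator {..d / real (2 ^ k)} (norm (x - y)) \<partial>lborel) \<partial>lborel))"
      using assms by (intro mult_left_mono double_integral_le_short_range) auto
    also have "\<dots> = ennreal ((2 ^ k) powr b) *
      (\<integral>\<^sup>+ x\<in>P. (\<integral>\<^sup>+ y\<in>P. ennreal \<bar>f x - f y\<bar> * indicator {..d / 2 ^ k} (norm (x - y)) \<partial>lborel) \<partial>lborel)"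
      unfolding pw[symmetric] using q by (simp add: ennreal_mult mult.assoc)
    also have "\<dots> = (\<integral>\<^sup>+ x. \<integral>\<^sup>+ y. g k x y \<partial>lborel \<partial>lborel)"
      by (subst set_nn_integral_double) (simp_all add: g_def[abs_def] i_def nn_integral_cmult[symmetric] mult_ac)
    finally show ?thesis .
  qed
  have "(\<Sum>k. ennreal (q ^ k)) = ennreal (1 / (1 - q))"
    using q by (intro suminf_ennreal_eq) (auto simp: geometric_sums)
  then have "ennreal (1 / (1 - q)) * ?A = (\<Sum>k. ennreal (q ^ k) * ?A)"
    by (simp add: ennreal_suminf_multc)
  also have "\<dots> \<le> (\<Sum>k. \<integral>\<^sup>+ x. \<integral>\<^sup>+ y. g k x y \<partial>lborel \<partial>lborel)"
    by (intro suminf_le scale) auto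
  also have "\<dots> = (\<integral>\<^sup>+ x. \<integral>\<^sup>+ y. (\<Sum>k. g k x y) \<partial>lborel \<partial>lborel)"
    by (simp add: nn_integral_suminf)
  also have "\<dots> \<le> (\<integral>\<^sup>+ x. \<integral>\<^sup>+ y. ennreal (2 * d powr b) *
      (ennreal (\<bar>f x - f y\<bar> / norm (x - y) powr b) * i x * i y) \<partial>lborel \<partial>lborel)"
  proof (intro nn_integral_mono)
    fix x y :: 'a
    show "(\<Sum>k. g k x y) \<le> ennreal (2 * d powr b) *
      (ennreal (\<bar>f x - f y\<bar> / norm (x - y) powr b) * i x * i y)"
    proof (cases "x = y")
      case False
      define r where "r = norm (x - y)"
      have r: "0 < r" using False by (simp add: r_def)
      have "(\<Sum>k. ennreal ((2 ^ k) powr b) * indicator {..d / 2 ^ k} r) \<le> ennreal (2 * (d / r) powr b)"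
      proof (intro suminf_le_const)
        fix K
        have "(\<Sum>k<K. ennreal ((2 ^ k) powr b) * indicator {..d / 2 ^ k} r)
           = (\<Sum>k<K. ennreal (if 2 ^ k \<le> d / r then (2 ^ k) powr b else 0))"
          using r by (intro sum.cong) (auto simp: field_simps indicator_def)
        also have "\<dots> = ennreal (\<Sum>k<K. if 2 ^ k \<le> d / r then (2 ^ k) powr b else 0)"
          by (intro sum_ennreal) auto
        also have "\<dots> \<le> ennreal (2 * (d / r) powr b)"
          by (intro ennreal_leI dyadic_sum_le b)
        finally show "(\<Sum>k<K. ennreal ((2 ^ k) powr b) * indicator {..d / 2 ^ k} r) \<le> ennreal (2 * (d / r) powr b)" .
      qed simp
      then have "ennreal \<bar>f x - f y\<bar> * (\<Sum>k. ennreal ((2 ^ k) powr b) * indicator {..d / 2 ^ k} r) * (i x * i y)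
        \<le> ennreal \<bar>f x - f y\<bar> * ennreal (2 * (d / r) powr b) * (i x * i y)"
        by (intro mult_right_mono mult_left_mono) auto
      also have "ennreal \<bar>f x - f y\<bar> * ennreal (2 * (d / r) powr b) = ennreal (2 * d powr b) * ennreal (\<bar>f x - f y\<bar> / r powr b)"
        using d0 r by (simp add: ennreal_mult[symmetric] powr_divide)
      finally have "ennreal \<bar>f x - f y\<bar> * (\<Sum>k. ennreal ((2 ^ k) powr b) * indicator {..d / 2 ^ k} r) * (i x * i y)
        \<le> ennreal (2 * d powr b) * ennreal (\<bar>f x - f y\<bar> / r powr b) * (i x * i y)" .
      moreover have "(\<Sum>k. g k x y)
        = ennreal \<bar>f x - f y\<bar> * (\<Sum>k. ennreal ((2 ^ k) powr b) * indicator {..d / 2 ^ k} r) * (i x * i y)"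
        unfolding g_def r_def mult.assoc[where c="i y"] by (simp only: ennreal_suminf_multc ennreal_suminf_cmult)
      ultimately show ?thesis
        by (simp add: r_def mult.assoc)
    qed (simp add: g_def)
  qed
  also have "\<dots> = ennreal (2 * d powr b) * ?B"
    by (simp add: i_def b_def set_nn_integral_double nn_integral_cmult)
  finally have *: "ennreal (1 / (1 - q)) * ?A \<le> ennreal (2 * d powr b) * ?B" .
  have "?A = ennreal (1 - q) * (ennreal (1 / (1 - q)) * ?A)"
    using q by (simp add: mult.assoc[symmetric] ennreal_mult[symmetric])
  also have "\<dots> \<le> ennreal (1 - \<delta>) * (ennreal (2 * d powr b) * ?B)"
    using \<open>1 - q \<le> 1 - \<delta>\<close> by (intro mult_mono * ennreal_leI) auto
  also have "\<dots> = ennreal ((1 - \<delta>) * (2 * d powr b)) * ?B"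
    using \<delta> d0 by (subst ennreal_mult) (auto simp: mult.assoc)
  finally show ?thesis
    by (simp add: b_def)
qed

section \<open>Half-open and dyadic cubes\<close>

text \<open>Cubes are half-open, so that the dyadic subcubes of one generation partition a cube without
  overlapping faces.\<close>

definition hcube :: "real ^ 'n \<Rightarrow> real \<Rightarrow> (real ^ 'n) set" where
  "hcube c l = {y. \<forall>i. c $ i \<le> y $ i \<and> y $ i < c $ i + l}"

lemma measurable_vec_nth [measurable]: "(\<lambda>x :: real ^ 'n. x $ i) \<in> borel_measurable borel"
  by (intro borel_measurable_continuous_onI continuous_intros)

lemma sets_hcube [measurable]: "hcube c l \<in> sets borel"
  unfolding hcube_def by measurable

lemma
  fixes c :: "real ^ 'n"
  assumes "0 \<le> l"
  shows emeasure_box_cube: "emeasure lborel (box c (\<chi> i. c $ i + l)) = ennreal (l ^ CARD('n))"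
    and emeasure_cbox_cube: "emeasure lborel (cbox c (\<chi> i. c $ i + l)) = ennreal (l ^ CARD('n))"
proof -
  have [simp]: "((\<chi> i. c $ i + l) - c) \<bullet> b = l" "c \<bullet> b \<le> (\<chi> i. c $ i + l) \<bullet> b" if "b \<in> Basis" for b
    using that assms by (auto simp: Basis_vec_def inner_axis)
  show "emeasure lborel (box c (\<chi> i. c $ i + l)) = ennreal (l ^ CARD('n))"
       "emeasure lborel (cbox c (\<chi> i. c $ i + l)) = ennreal (l ^ CARD('n))"
    by simp_all
qed

lemma hcube_subset_cbox: "hcube c l \<subseteq> cbox c (\<chi> i. c $ i + l)"
  by (auto simp: hcube_def mem_box_cart less_imp_le)

lemma box_subset_hcube: "box c (\<chi> i. c $ i + l) \<subseteq> hcube c l"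
  by (auto simp: hcube_def mem_box_cart less_imp_le)

lemma emeasure_hcube:
  fixes c :: "real ^ 'n"
  assumes "0 \<le> l"
  shows "emeasure lborel (hcube c l) = ennreal (l ^ CARD('n))"
  using emeasure_mono[OF hcube_subset_cbox[of c l], of lborel]
    emeasure_mono[OF box_subset_hcube[of c l], of lborel]
    emeasure_box_cube[OF assms, of c] emeasure_cbox_cube[OF assms, of c]
  by (simp add: antisym)

lemma is_cube_hcube: "0 < l \<Longrightarrow> is_cube (hcube c l)"
  unfolding is_cube_def hcube_def
  by (intro exI[of _ l] conjI exI[of _ "\<lambda>i. c $ i"] exI[of _ "\<lambda>i. {c $ i ..< c $ i + l}"]) auto

lemma is_cube_AE_eq_hcube:
  fixes Q :: "(real ^ 'n) set"
  assumes "is_cube Q"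
  obtains c l where "0 < l" "AE x in lborel. x \<in> Q \<longleftrightarrow> x \<in> hcube c l"
proof -
  obtain l a I where l: "0 < l" and I: "\<And>i. {a i <..< a i + l} \<subseteq> I i \<and> I i \<subseteq> {a i .. a i + l}"
    and Q: "Q = {x. \<forall>i. x $ i \<in> I i}"
    using assms unfolding is_cube_def by blast
  define c :: "real ^ 'n" where "c = (\<chi> i. a i)"
  let ?b = "box c (\<chi> i. c $ i + l)" and ?c = "cbox c (\<chi> i. c $ i + l)"
  have "emeasure lborel (?c - ?b) = 0"
    using l by (subst emeasure_Diff)
      (auto simp: emeasure_box_cube emeasure_cbox_cube box_subset_cbox simp del: emeasure_lborel_box emeasure_lborel_cbox)
  then have "AE x in lborel. x \<notin> ?c - ?b"
    by (intro AE_not_in) (auto simp: null_sets_def)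
  moreover have "?b \<subseteq> Q" "Q \<subseteq> ?c"
    using I unfolding Q c_def by (fastforce simp: mem_box_cart)+
  then have "x \<in> Q \<longleftrightarrow> x \<in> hcube c l" if "x \<notin> ?c - ?b" for x
    using that hcube_subset_cbox[of c l] box_subset_hcube[of c l] by blast
  ultimately have "AE x in lborel. x \<in> Q \<longleftrightarrow> x \<in> hcube c l"
    by (auto elim!: eventually_mono)
  with l that show thesis by blast
qed

lemma convex_hcube: "convex (hcube c l)"
proof -
  have "hcube c l = (\<Inter>i. {y. c $ i \<le> y $ i} \<inter> {y. y $ i < c $ i + l})"
    by (auto simp: hcube_def)
  moreover have "convex {y :: real ^ 'a. c $ i \<le> y $ i}" "convex {y :: real ^ 'a. y $ i < c $ i + l}" for i
    using convex_halfspace_ge[of "c $ i" "axis i (1 :: real)"] convex_halfspace_lt[of "axis i (1 :: real)" "c $ i + l"]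
    by (simp_all add: inner_axis')
  ultimately show ?thesis
    by (auto intro!: convex_INT convex_Int)
qed

lemma norm_diff_hcube_le:
  fixes x :: "real ^ 'n" and l :: real
  assumes "x \<in> hcube c l" "y \<in> hcube c l"
  shows "norm (x - y) \<le> CARD('n) * l"
proof -
  have "norm (x - y) \<le> (\<Sum>i\<in>UNIV. \<bar>(x - y) $ i\<bar>)"
    by (rule norm_le_l1_cart)
  also have "\<dots> \<le> (\<Sum>i\<in>(UNIV :: 'n set). l)"
  proof (intro sum_mono)
    fix i
    have "c $ i \<le> x $ i" "x $ i < c $ i + l" "c $ i \<le> y $ i" "y $ i < c $ i + l"
      using assms by (auto simp: hcube_def)
    then show "\<bar>(x - y) $ i\<bar> \<le> l"
      by simp
  qed
  finally show ?thesis by simp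
qed

text \<open>The dyadic cube of generation \<open>k\<close> around \<open>x\<close>, in the grid that has \<open>hcube a l\<close> as a cell of
  generation \<open>0\<close>.  It consists of the points with the same integer parts of the rescaled
  coordinates, so cubes of one generation are the classes of an equivalence relation.\<close>

definition dyadic_cube :: "real ^ 'n \<Rightarrow> real \<Rightarrow> nat \<Rightarrow> real ^ 'n \<Rightarrow> (real ^ 'n) set" where
  "dyadic_cube a l k x = {y. \<forall>i. \<lfloor>(y $ i - a $ i) / l * 2 ^ k\<rfloor> = \<lfloor>(x $ i - a $ i) / l * 2 ^ k\<rfloor>}"

lemma mem_dyadic_cube_self [simp]: "x \<in> dyadic_cube a l k x"
  by (simp add: dyadic_cube_def)

lemma dyadic_cube_eq: "y \<in> dyadic_cube a l k x \<Longrightarrow> dyadic_cube a l k y = dyadic_cube a l k x"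
  by (simp add: dyadic_cube_def)

lemma dyadic_cube_eq_hcube:
  assumes "0 < l"
  obtains c where "dyadic_cube a l k x = hcube c (l / 2 ^ k)"
proof -
  define z where "z i = real_of_int \<lfloor>(x $ i - a $ i) / l * 2 ^ k\<rfloor>" for i
  have "(\<lfloor>(y $ i - a $ i) / l * 2 ^ k\<rfloor> = \<lfloor>(x $ i - a $ i) / l * 2 ^ k\<rfloor>) \<longleftrightarrow>
     (a $ i + z i * (l / 2 ^ k) \<le> y $ i \<and> y $ i < a $ i + z i * (l / 2 ^ k) + l / 2 ^ k)" for y i
  proof -
    have "(\<lfloor>(y $ i - a $ i) / l * 2 ^ k\<rfloor> = \<lfloor>(x $ i - a $ i) / l * 2 ^ k\<rfloor>) \<longleftrightarrow>
      z i \<le> (y $ i - a $ i) / l * 2 ^ k \<and> (y $ i - a $ i) / l * 2 ^ k < z i + 1"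
      unfolding z_def by (rule floor_eq_iff)
    also have "\<dots> \<longleftrightarrow> (a $ i + z i * (l / 2 ^ k) \<le> y $ i \<and> y $ i < a $ i + z i * (l / 2 ^ k) + l / 2 ^ k)"
      using assms by (simp add: field_simps)
    finally show ?thesis .
  qed
  then have "dyadic_cube a l k x = hcube (\<chi> i. a $ i + z i * (l / 2 ^ k)) (l / 2 ^ k)"
    by (simp add: dyadic_cube_def hcube_def)
  then show thesis by (rule that)
qed

lemma sets_dyadic_cube [measurable]: "dyadic_cube a l k x \<in> sets borel"
  unfolding dyadic_cube_def by measurable

lemma measurable_dyadic_cube_pred [measurable]:
  "Measurable.pred (borel \<Otimes>\<^sub>M borel) (\<lambda>(x, y). y \<in> dyadic_cube a l k x)"
  unfolding dyadic_cube_def by measurable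

lemma emeasure_dyadic_cube:
  fixes a :: "real ^ 'n"
  assumes "0 < l"
  shows "emeasure lborel (dyadic_cube a l k x) = ennreal ((l / 2 ^ k) ^ CARD('n))"
  using dyadic_cube_eq_hcube[OF assms, of a k x] assms emeasure_hcube[of "l / 2 ^ k"]
  by (metis divide_nonneg_pos less_imp_le zero_less_numeral zero_less_power)

lemma dyadic_cube_0:
  assumes "0 < l" "x \<in> hcube a l"
  shows "dyadic_cube a l 0 x = hcube a l"
proof -
  have f: "\<lfloor>(y $ i - a $ i) / l\<rfloor> = 0 \<longleftrightarrow> a $ i \<le> y $ i \<and> y $ i < a $ i + l" for y i
    using assms(1) by (auto simp: floor_eq_iff field_simps)
  have fx: "\<lfloor>(x $ i - a $ i) / l\<rfloor> = 0" for i
    using assms(2) unfolding f by (simp add: hcube_def)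
  show ?thesis
    by (simp add: dyadic_cube_def hcube_def fx f)
qed

lemma floor_eq_floor_coarser:
  fixes u v :: real
  assumes "\<lfloor>u * 2 ^ k\<rfloor> = \<lfloor>v * 2 ^ k\<rfloor>" "j \<le> k"
  shows "\<lfloor>u * 2 ^ j\<rfloor> = \<lfloor>v * 2 ^ j\<rfloor>"
proof -
  have "\<lfloor>u * 2 ^ j\<rfloor> = \<lfloor>u * 2 ^ k\<rfloor> div 2 ^ (k - j)" for u :: real
  proof -
    have "u * 2 ^ j = u * 2 ^ k / of_int (2 ^ (k - j))"
      using assms(2) by (simp add: field_simps power_add[symmetric])
    then show ?thesis
      by (simp only: floor_divide_real_eq_div[of "2 ^ (k - j)"] zero_le_power zero_le_numeral)
  qed
  then show ?thesis using assms(1) by simp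
qed

lemma dyadic_cube_antimono: "j \<le> k \<Longrightarrow> dyadic_cube a l k x \<subseteq> dyadic_cube a l j x"
  unfolding dyadic_cube_def using floor_eq_floor_coarser by blast

lemma dyadic_cube_subset_hcube:
  "0 < l \<Longrightarrow> x \<in> hcube a l \<Longrightarrow> dyadic_cube a l k x \<subseteq> hcube a l"
  using dyadic_cube_antimono[of 0 k] dyadic_cube_0 by blast

lemma countable_dyadic_cubes:
  fixes a :: "real ^ 'n"
  shows "countable {dyadic_cube a l k x | k x. True}"
proof (rule countable_subset)
  show "{dyadic_cube a l k x | k x. True} \<subseteq>
    (\<lambda>(k, m :: int ^ 'n). {y. \<forall>i. \<lfloor>(y $ i - a $ i) / l * 2 ^ k\<rfloor> = m $ i}) ` UNIV"
  proof safe
    fix k x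
    show "dyadic_cube a l k x \<in> range (\<lambda>(k, m :: int ^ 'n). {y. \<forall>i. \<lfloor>(y $ i - a $ i) / l * 2 ^ k\<rfloor> = m $ i})"
      by (intro image_eqI[of _ _ "(k, \<chi> i. \<lfloor>(x $ i - a $ i) / l * 2 ^ k\<rfloor>)"]) (auto simp: dyadic_cube_def)
  qed
qed simp

lemma dyadic_cube_subset_open:
  fixes a :: "real ^ 'n"
  assumes "0 < l" "open U" "x \<in> U"
  obtains k where "dyadic_cube a l k x \<subseteq> U"
proof -
  obtain e where e: "0 < e" "ball x e \<subseteq> U"
    using assms openE by blast
  obtain k where k: "CARD('n) * l / e < 2 ^ k"
    using real_arch_pow[of 2] by auto
  have "dyadic_cube a l k x \<subseteq> ball x e"
  proof
    fix y assume y: "y \<in> dyadic_cube a l k x"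
    obtain c where c: "dyadic_cube a l k x = hcube c (l / 2 ^ k)"
      using dyadic_cube_eq_hcube[OF assms(1)] by blast
    have "norm (x - y) \<le> CARD('n) * (l / 2 ^ k)"
      using y mem_dyadic_cube_self[of x a l k] unfolding c by (intro norm_diff_hcube_le)
    also have "\<dots> < e"
      using k e by (simp add: field_simps)
    finally show "y \<in> ball x e"
      by (simp add: dist_norm)
  qed
  with e that show thesis by blast
qed

text \<open>At every point of \<open>A\<close>, stop at the first generation whose cube has the property \<open>G\<close>.  If two
  of the selected cubes meet, then the cube of the earlier generation also surrounds the base
  point of the other, where the process would have stopped at that generation as well; so the
  cubes coincide.\<close>

lemma dyadic_stopping_cover:
  fixes a :: "real ^ 'n"
  assumes "\<And>x. x \<in> A \<Longrightarrow> \<exists>k. G (dyadic_cube a l k x)"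
  shows "\<exists>\<P>. countable \<P> \<and> disjoint \<P> \<and> A \<subseteq> \<Union>\<P> \<and>
    (\<forall>P\<in>\<P>. G P \<and> (\<exists>k. \<exists>x\<in>A. P = dyadic_cube a l k x))"
proof -
  define D where "D = dyadic_cube a l"
  define j where "j x = (LEAST k. G (D k x))" for x
  define \<P> where "\<P> = (\<lambda>x. D (j x) x) ` A"
  have G: "G (D (j x) x)" if "x \<in> A" for x
    unfolding j_def D_def using assms[OF that] by (rule LeastI_ex)
  have same: "D (j x) x = D (j x') x'"
    if x: "x \<in> A" "x' \<in> A" "j x \<le> j x'" and y: "y \<in> D (j x) x" "y \<in> D (j x') x'" for x x' y
  proof -
    have "D (j x) x = D (j x) y"
      using dyadic_cube_eq[OF y(1)[unfolded D_def]] by (simp add: D_def)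
    also have "\<dots> = D (j x) x'"
      using y(2) x(3) dyadic_cube_antimono[of "j x" "j x'"] dyadic_cube_eq by (fastforce simp: D_def)
    finally have eq: "D (j x) x = D (j x) x'" .
    then have "j x' \<le> j x"
      using G[OF x(1)] unfolding j_def[of x'] by (intro Least_le) simp
    then show ?thesis
      using eq x(3) by simp
  qed
  have "countable \<P>"
    by (rule countable_subset[OF _ countable_dyadic_cubes[of a l]]) (auto simp: \<P>_def D_def)
  moreover have "A \<subseteq> \<Union>\<P>"
    by (auto simp: \<P>_def D_def)
  moreover have "disjoint \<P>"
    unfolding \<P>_def disjoint_def
  proof (intro ballI impI; elim imageE)
    fix P P' x x'
    assume *: "P \<noteq> P'" "x \<in> A" "x' \<in> A" "P = D (j x) x" "P' = D (j x') x'"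
    then show "P \<inter> P' = {}"
      using same[of x x'] same[of x' x] by (cases "j x \<le> j x'") auto
  qed
  moreover have "\<forall>P\<in>\<P>. G P \<and> (\<exists>k. \<exists>x\<in>A. P = dyadic_cube a l k x)"
    using G by (auto simp: \<P>_def D_def)
  ultimately show ?thesis by blast
qed

lemma measurable_dyadic_integral [measurable]:
  assumes [measurable]: "f \<in> borel_measurable borel"
  shows "(\<lambda>x. \<integral>\<^sup>+ y\<in>dyadic_cube a l k x. f y \<partial>lborel) \<in> borel_measurable borel"
proof -
  have "(\<lambda>x. \<integral>\<^sup>+ y. f y * (if y \<in> dyadic_cube a l k x then 1 else 0) \<partial>lborel) \<in> borel_measurable borel"
    by measurable
  then show ?thesis
    by (simp add: indicator_def)
qed

text \<open>A weak form of the Lebesgue density theorem.  If the set \<open>A\<close> of exceptional points had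
  positive measure \<open>e\<close>, cover it by an open set \<open>U\<close> with \<open>\<bar>U - A\<bar> < e\<close> and split \<open>A\<close> along disjoint
  dyadic cubes inside \<open>U\<close>.  Each of them is at most half full of \<open>A\<close>, so \<open>\<bar>A\<bar> \<le> \<bar>U - A\<bar>\<close>.\<close>

lemma null_set_dyadic_sparse:
  fixes a :: "real ^ 'n"
  assumes l: "0 < l" and [measurable]: "E \<in> sets borel"
  shows "{x \<in> E \<inter> hcube a l.
    \<forall>k. 2 * emeasure lborel (E \<inter> dyadic_cube a l k x) \<le> emeasure lborel (dyadic_cube a l k x)}
    \<in> null_sets lborel"
proof (rule ccontr)
  define A where "A = {x \<in> E \<inter> hcube a l.
    \<forall>k. 2 * emeasure lborel (E \<inter> dyadic_cube a l k x) \<le> emeasure lborel (dyadic_cube a l k x)}"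
  have eq: "emeasure lborel (E \<inter> dyadic_cube a l k x) = (\<integral>\<^sup>+ y\<in>dyadic_cube a l k x. indicator E y \<partial>lborel)" for k x
    by (simp add: indicator_inter_arith[symmetric])
  have [measurable]: "(\<lambda>x. emeasure lborel (E \<inter> dyadic_cube a l k x)) \<in> borel_measurable borel" for k
    unfolding eq by measurable
  have [measurable]: "A \<in> sets borel"
    unfolding A_def emeasure_dyadic_cube[OF l] by measurable
  have "emeasure lborel A \<le> emeasure lborel (hcube a l)"
    by (intro emeasure_mono) (auto simp: A_def)
  also have "\<dots> < \<infinity>"
    using l by (simp add: emeasure_hcube)
  finally have fin: "emeasure lborel A < \<infinity>" .
  assume "{x \<in> E \<inter> hcube a l.
    \<forall>k. 2 * emeasure lborel (E \<inter> dyadic_cube a l k x) \<le> emeasure lborel (dyadic_cube a l k x)}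
    \<notin> null_sets lborel"
  then have "A \<notin> null_sets lborel"
    unfolding A_def .
  then have "emeasure lborel A \<noteq> 0"
    by (simp add: null_sets_def)
  with fin obtain e where e: "emeasure lborel A = ennreal e" "0 < e"
    by (cases "emeasure lborel A" rule: ennreal_cases) (auto simp: less_le)
  then obtain U where U: "open U" "A \<subseteq> U" "emeasure lborel (U - A) < ennreal e"
    using outer_regular_lborel[of A e] by auto
  have [measurable]: "U \<in> sets borel"
    using U by simp
  have "\<exists>k. dyadic_cube a l k x \<subseteq> U" if "x \<in> A" for x
    using that U(2) dyadic_cube_subset_open[OF l U(1), of x a] by blast
  from dyadic_stopping_cover[of A "\<lambda>P. P \<subseteq> U", OF this]
  obtain \<P> where "countable \<P> \<and> disjoint \<P> \<and> A \<subseteq> \<Union>\<P> \<and>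
    (\<forall>P\<in>\<P>. P \<subseteq> U \<and> (\<exists>k. \<exists>x\<in>A. P = dyadic_cube a l k x))" ..
  then have \<P>: "countable \<P>" "disjoint \<P>" "A \<subseteq> \<Union>\<P>"
    and P_U: "\<And>P. P \<in> \<P> \<Longrightarrow> P \<subseteq> U"
    and P_dyadic: "\<And>P. P \<in> \<P> \<Longrightarrow> \<exists>k. \<exists>x\<in>A. P = dyadic_cube a l k x"
    by simp_all
  have [measurable]: "P \<in> sets borel" if "P \<in> \<P>" for P
    using P_dyadic[OF that] by auto
  have disj: "disjoint_family_on (\<lambda>P. P) \<P>"
    using \<P>(2) by (auto simp: disjoint_family_on_def disjoint_def)
  have half: "emeasure lborel (A \<inter> P) \<le> emeasure lborel (P - A)" if P: "P \<in> \<P>" for P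
  proof -
    obtain k x where x: "x \<in> A" "P = dyadic_cube a l k x"
      using P_dyadic[OF P] by blast
    have [measurable]: "P \<in> sets borel" using x by simp
    have "emeasure lborel (A \<inter> P) \<le> emeasure lborel (E \<inter> P)"
      by (intro emeasure_mono) (auto simp: A_def)
    then have "2 * emeasure lborel (A \<inter> P) \<le> 2 * emeasure lborel (E \<inter> P)"
      by (intro mult_left_mono) auto
    also have "\<dots> \<le> emeasure lborel P"
      using x by (auto simp: A_def)
    also have "\<dots> = emeasure lborel (A \<inter> P) + emeasure lborel (P - A)"
      by (subst plus_emeasure) (auto intro!: arg_cong[where f="emeasure lborel"])
    finally have "emeasure lborel (A \<inter> P) + emeasure lborel (A \<inter> P)
       \<le> emeasure lborel (A \<inter> P) + emeasure lborel (P - A)"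
      by (simp add: mult_2)
    moreover have "emeasure lborel (A \<inter> P) \<noteq> \<infinity>"
      using fin emeasure_mono[of "A \<inter> P" A lborel] by (auto simp: top_unique)
    ultimately show ?thesis
      by (simp add: ennreal_add_left_cancel_le)
  qed
  have "emeasure lborel A = emeasure lborel (\<Union>P\<in>\<P>. A \<inter> P)"
    using \<P>(3) by (intro arg_cong[where f="emeasure lborel"]) auto
  also have "\<dots> = (\<integral>\<^sup>+ P. emeasure lborel (A \<inter> P) \<partial>count_space \<P>)"
    using disj \<P>(1) by (intro emeasure_UN_countable) (auto simp: disjoint_family_on_def)
  also have "\<dots> \<le> (\<integral>\<^sup>+ P. emeasure lborel (P - A) \<partial>count_space \<P>)"
    using half by (intro nn_integral_mono) auto
  also have "\<dots> = emeasure lborel (\<Union>P\<in>\<P>. P - A)"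
    using disj \<P>(1) by (intro emeasure_UN_countable[symmetric]) (auto simp: disjoint_family_on_def)
  also have "\<dots> \<le> emeasure lborel (U - A)"
    using P_U by (intro emeasure_mono) auto
  also have "\<dots> < emeasure lborel A"
    using U e by simp
  finally show False by simp
qed

section \<open>A weighted isoperimetric inequality\<close>

definition dyadic_maximal :: "real ^ 'n \<Rightarrow> real \<Rightarrow> (real ^ 'n \<Rightarrow> ennreal) \<Rightarrow> real ^ 'n \<Rightarrow> ennreal" where
  "dyadic_maximal a l \<omega> x =
     (SUP k. (\<integral>\<^sup>+ y\<in>dyadic_cube a l k x. \<omega> y \<partial>lborel) / emeasure lborel (dyadic_cube a l k x))"

lemma measurable_dyadic_maximal [measurable]:
  assumes [measurable]: "\<omega> \<in> borel_measurable borel" and "0 < l"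
  shows "dyadic_maximal a l \<omega> \<in> borel_measurable borel"
  unfolding dyadic_maximal_def[abs_def] emeasure_dyadic_cube[OF assms(2)] by measurable

text \<open>The inner integral of the fractional seminorm.\<close>

definition kernel_energy :: "real \<Rightarrow> (real ^ 'n) set \<Rightarrow> (real ^ 'n \<Rightarrow> real) \<Rightarrow> real ^ 'n \<Rightarrow> ennreal" where
  "kernel_energy \<delta> Q u x =
     (\<integral>\<^sup>+ y\<in>Q. ennreal (\<bar>u x - u y\<bar> / norm (x - y) powr (real CARD('n) + \<delta>)) \<partial>lborel)"

lemma measurable_kernel_energy [measurable]:
  assumes [measurable]: "u \<in> borel_measurable borel" "Q \<in> sets borel"
  shows "kernel_energy \<delta> Q u \<in> borel_measurable borel"
  unfolding kernel_energy_def[abs_def] by measurable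

lemma kernel_energy_mono: "P \<subseteq> Q \<Longrightarrow> kernel_energy \<delta> P u x \<le> kernel_energy \<delta> Q u x"
  unfolding kernel_energy_def by (intro nn_integral_mono mult_left_mono) (auto simp: indicator_def)

lemma less_card: "\<delta> < 1 \<Longrightarrow> \<delta> < real CARD('n :: finite)"
proof -
  have "1 \<le> real CARD('n)"
    by (simp add: Suc_leI)
  then show "\<delta> < 1 \<Longrightarrow> \<delta> < real CARD('n)"
    by linarith
qed

text \<open>The constant of the isoperimetric inequality below; the argument of type \<open>'n itself\<close> carries
  the dimension.\<close>

definition iso_const :: "'n itself \<Rightarrow> real \<Rightarrow> real" where
  "iso_const _ \<delta> = (1 - \<delta>) * (2 ^ (CARD('n) + 3) * real CARD('n) ^ (CARD('n) + 1))"

text \<open>The double integral of \<open>\<bar>1\<^sub>E x - 1\<^sub>E y\<bar>\<close> over \<open>P \<times> P\<close> is at least \<open>\<bar>E \<inter> P\<bar> \<bar>P - E\<bar>\<close>, which is at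
  least \<open>\<bar>P\<bar>\<^sup>2 = r\<^sup>2\<^sup>n\<close> up to a constant, since neither part is small.  The fractional Poincare
  inequality on \<open>P\<close> costs \<open>r\<close> to the power \<open>n + \<delta>\<close>, which leaves \<open>r\<close> to the power \<open>n - \<delta>\<close>.\<close>

lemma half_filled_cube_le_energy:
  fixes c :: "real ^ 'n"
  assumes [measurable]: "E \<in> sets borel" and r: "0 < r" and \<delta>: "0 < \<delta>" "\<delta> < 1"
    and half: "2 * emeasure lborel (E \<inter> hcube c r) \<le> emeasure lborel (hcube c r)"
    and thick: "emeasure lborel (hcube c r) \<le> 2 ^ (CARD('n) + 1) * emeasure lborel (E \<inter> hcube c r)"
  shows "ennreal (r powr (real CARD('n) - \<delta>)) \<le> ennreal (iso_const TYPE('n) \<delta>) *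
    (\<integral>\<^sup>+ x\<in>hcube c r. kernel_energy \<delta> (hcube c r) (indicator E) x \<partial>lborel)"
proof -
  let ?P = "hcube c r" and ?n = "CARD('n)"
  let ?B = "\<integral>\<^sup>+ x\<in>?P. kernel_energy \<delta> ?P (indicator E) x \<partial>lborel"
  have P: "emeasure lborel ?P = ennreal (r ^ ?n)"
    using r by (simp add: emeasure_hcube)
  define \<alpha> where "\<alpha> = measure lborel (E \<inter> ?P)"
  have "emeasure lborel (E \<inter> ?P) \<le> emeasure lborel ?P"
    by (intro emeasure_mono) auto
  then have fin: "emeasure lborel (E \<inter> ?P) \<noteq> \<infinity>"
    using P by (auto simp: top_unique)
  then have \<alpha>: "emeasure lborel (E \<inter> ?P) = ennreal \<alpha>" "0 \<le> \<alpha>"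
    by (simp_all add: \<alpha>_def emeasure_eq_ennreal_measure)
  have \<alpha>_half: "2 * \<alpha> \<le> r ^ ?n"
    using half r \<alpha>(2) unfolding P \<alpha>(1) by (simp add: ennreal_mult[symmetric] flip: ennreal_numeral)
  have "2 ^ (?n + 1) = ennreal (2 ^ (?n + 1))"
    by (simp add: ennreal_power[symmetric] del: power_Suc)
  then have \<alpha>_thick: "r ^ ?n \<le> 2 ^ (?n + 1) * \<alpha>"
    using thick r \<alpha>(2) unfolding P \<alpha>(1) by (simp add: ennreal_mult[symmetric] del: power_Suc)
  have "emeasure lborel (?P - E) = emeasure lborel (?P - (E \<inter> ?P))"
    by (intro arg_cong[where f="emeasure lborel"]) auto
  also have "\<dots> = ennreal (r ^ ?n - \<alpha>)"
    using fin \<alpha> P by (subst emeasure_Diff) (auto simp: ennreal_minus)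
  finally have co: "emeasure lborel (?P - E) = ennreal (r ^ ?n - \<alpha>)" .
  have "r ^ ?n * r ^ ?n \<le> (2 ^ (?n + 1) * \<alpha>) * (2 * (r ^ ?n - \<alpha>))"
    using \<alpha>_half \<alpha>_thick \<alpha>(2) r by (intro mult_mono) auto
  also have "\<dots> = 2 ^ (?n + 2) * (\<alpha> * (r ^ ?n - \<alpha>))"
    by simp
  finally have low: "r ^ ?n * r ^ ?n / 2 ^ (?n + 2) \<le> \<alpha> * (r ^ ?n - \<alpha>)"
    by (simp add: field_simps)
  have "ennreal (\<alpha> * (r ^ ?n - \<alpha>)) = (\<integral>\<^sup>+ x. indicator (E \<inter> ?P) x * emeasure lborel (?P - E) \<partial>lborel)"
    using \<alpha> \<alpha>_half unfolding co by (simp add: nn_integral_multc ennreal_mult)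
  also have "\<dots> \<le> (\<integral>\<^sup>+ x\<in>?P. (\<integral>\<^sup>+ y\<in>?P. ennreal \<bar>indicator E x - indicator E y\<bar> \<partial>lborel) \<partial>lborel)"
  proof (rule nn_integral_mono)
    fix x
    show "indicator (E \<inter> ?P) x * emeasure lborel (?P - E)
      \<le> (\<integral>\<^sup>+ y\<in>?P. ennreal \<bar>indicator E x - indicator E y\<bar> \<partial>lborel) * indicator ?P x"
    proof (cases "x \<in> E \<inter> ?P")
      case True
      have "emeasure lborel (?P - E) = (\<integral>\<^sup>+ y. indicator (?P - E) y \<partial>lborel)"
        by simp
      also have "\<dots> \<le> (\<integral>\<^sup>+ y\<in>?P. ennreal \<bar>indicator E x - indicator E y\<bar> \<partial>lborel)"
        using True by (intro nn_integral_mono) (auto simp: indicator_def)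
      finally show ?thesis using True by simp
    qed simp
  qed
  also have "\<dots> \<le> ennreal ((1 - \<delta>) * (2 * (real ?n * r) powr (real ?n + \<delta>))) * ?B"
    using fractional_poincare[of "indicator E" ?P "real ?n * r" \<delta>, OF _ _ convex_hcube norm_diff_hcube_le] r \<delta>
    by (simp add: kernel_energy_def)
  finally have base: "ennreal (r ^ ?n * r ^ ?n / 2 ^ (?n + 2))
      \<le> ennreal ((1 - \<delta>) * (2 * (real ?n * r) powr (real ?n + \<delta>))) * ?B"
    using order_trans[OF ennreal_leI[OF low]] by blast
  \<comment> \<open>The factor that turns the left-hand side of the last estimate into a pure power of \<open>r\<close>.\<close>
  define \<gamma> where "\<gamma> = 2 ^ (?n + 2) / r powr (real ?n + \<delta>)"
  have \<gamma>: "0 \<le> \<gamma>"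
    by (simp add: \<gamma>_def)
  have "r ^ ?n * r ^ ?n / r powr (real ?n + \<delta>) = r powr (real ?n + real ?n - (real ?n + \<delta>))"
    using r by (simp add: powr_realpow powr_diff powr_add)
  then have "r powr (real ?n - \<delta>) = \<gamma> * (r ^ ?n * r ^ ?n / 2 ^ (?n + 2))"
    by (simp add: \<gamma>_def)
  then have "ennreal (r powr (real ?n - \<delta>)) = ennreal \<gamma> * ennreal (r ^ ?n * r ^ ?n / 2 ^ (?n + 2))"
    using \<gamma> by (simp only: ennreal_mult')
  also have "\<dots> \<le> ennreal \<gamma> * (ennreal ((1 - \<delta>) * (2 * (real ?n * r) powr (real ?n + \<delta>))) * ?B)"
    by (intro mult_left_mono base) simp
  also have "\<dots> = ennreal (\<gamma> * ((1 - \<delta>) * (2 * (real ?n * r) powr (real ?n + \<delta>)))) * ?B"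
    using \<gamma> by (simp only: ennreal_mult' mult.assoc)
  finally have *: "ennreal (r powr (real ?n - \<delta>))
      \<le> ennreal (\<gamma> * ((1 - \<delta>) * (2 * (real ?n * r) powr (real ?n + \<delta>)))) * ?B" .
  have "real ?n powr (real ?n + \<delta>) \<le> real ?n powr real (?n + 1)"
    using \<delta> by (intro powr_mono) (auto simp: Suc_leI)
  also have "\<dots> = real ?n ^ (?n + 1)"
    by (rule powr_realpow) simp
  finally have "real ?n powr (real ?n + \<delta>) \<le> real ?n ^ (?n + 1)" .
  then have "(1 - \<delta>) * (2 ^ (?n + 3) * real ?n powr (real ?n + \<delta>)) \<le> iso_const TYPE('n) \<delta>"
    unfolding iso_const_def using \<delta> by (intro mult_left_mono) auto
  moreover have "\<gamma> * ((1 - \<delta>) * (2 * (real ?n * r) powr (real ?n + \<delta>))) = (1 - \<delta>) * (2 ^ (?n + 3) * real ?n powr (real ?n + \<delta>))"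
    using r by (simp add: \<gamma>_def powr_mult power_add field_simps)
  ultimately have "ennreal (\<gamma> * ((1 - \<delta>) * (2 * (real ?n * r) powr (real ?n + \<delta>)))) \<le> ennreal (iso_const TYPE('n) \<delta>)"
    by (simp only: ennreal_leI)
  then show ?thesis
    by (intro order_trans[OF *] mult_right_mono) simp_all
qed

text \<open>A cube is good if \<open>E\<close> fills at most half of it, but not less than a fixed proportion.  Almost
  every point of \<open>E \<inter> Q\<close> lies in a good dyadic subcube of \<open>Q\<close>, namely in the parent of the first
  dyadic cube around it that is more than half full.  The first good cubes are disjoint, and for
  each of them the energy inside \<open>P\<close> bounds the side length to the power \<open>n - \<delta>\<close>, which is
  \<open>\<bar>P\<bar>\<^sup>s\<close>; multiplied by \<open>(W P / \<bar>P\<bar>)\<^sup>s\<close>, which is at most the maximal function to the power \<open>s\<close>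
  on \<open>P\<close>, it becomes \<open>(W P)\<^sup>s\<close>, where \<open>W\<close> is the measure with density \<open>\<omega>\<close>.\<close>

lemma weighted_isoperimetric:
  fixes a :: "real ^ 'n"
  assumes [measurable]: "E \<in> sets borel" "\<omega> \<in> borel_measurable borel"
    and l: "0 < l" and \<delta>: "0 < \<delta>" "\<delta> < 1"
    and half: "2 * emeasure lborel (E \<inter> hcube a l) \<le> emeasure lborel (hcube a l)"
  defines "s \<equiv> (real CARD('n) - \<delta>) / CARD('n)"
  shows "ennreal_powr (\<integral>\<^sup>+ x\<in>E \<inter> hcube a l. \<omega> x \<partial>lborel) s \<le> ennreal (iso_const TYPE('n) \<delta>) *
    (\<integral>\<^sup>+ x\<in>hcube a l. kernel_energy \<delta> (hcube a l) (indicator E) x * ennreal_powr (dyadic_maximal a l \<omega> x) s \<partial>lborel)"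
proof -
  let ?n = "CARD('n)" and ?K = "ennreal (iso_const TYPE('n) \<delta>)"
  let ?Q = "hcube a l" and ?D = "dyadic_cube a l" and ?M = "dyadic_maximal a l \<omega>"
  note [measurable] = measurable_dyadic_maximal[OF assms(2) l]
  define W where "W = density lborel \<omega>"
  have W: "(\<integral>\<^sup>+ x\<in>S. \<omega> x \<partial>lborel) = emeasure W S" if "S \<in> sets borel" for S
    using that by (simp add: W_def emeasure_density)
  have [measurable_cong]: "sets W = sets borel"
    by (simp add: W_def)
  have "\<delta> < real ?n"
    using \<delta> by (intro less_card)
  then have s: "0 < s" "s < 1"
    using \<delta> by (auto simp: s_def field_simps)
  define good where "good P \<longleftrightarrow> 2 * emeasure lborel (E \<inter> P) \<le> emeasure lborel P \<and>
    emeasure lborel P \<le> 2 ^ (?n + 1) * emeasure lborel (E \<inter> P)" for P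
  define A where "A = {x \<in> ?Q. \<exists>k. good (?D k x)}"
  define N where "N = {x \<in> E \<inter> ?Q. \<forall>k. 2 * emeasure lborel (E \<inter> ?D k x) \<le> emeasure lborel (?D k x)}"
  have cover: "E \<inter> ?Q \<subseteq> A \<union> N"
  proof
    fix x assume x: "x \<in> E \<inter> ?Q"
    show "x \<in> A \<union> N"
    proof (cases "x \<in> N")
      case False
      define dense where "dense k \<longleftrightarrow> \<not> 2 * emeasure lborel (E \<inter> ?D k x) \<le> emeasure lborel (?D k x)" for k
      define j where "j = (LEAST k. dense k)"
      have "\<exists>k. dense k"
        using False x by (auto simp: N_def dense_def)
      then have j: "dense j"
        unfolding j_def by (rule LeastI_ex)
      have "\<not> dense 0"
        using half x dyadic_cube_0[OF l, of x a] by (simp add: dense_def)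
      with j obtain i where i: "j = Suc i"
        by (cases j) auto
      have "\<not> dense i"
        using not_less_Least[of i dense] i by (simp add: j_def)
      moreover have "emeasure lborel (?D i x) \<le> 2 ^ (?n + 1) * emeasure lborel (E \<inter> ?D i x)"
      proof -
        have "(l / 2 ^ i) ^ ?n = 2 ^ ?n * (l / 2 ^ j) ^ ?n"
          by (simp add: i power_divide power_mult_distrib)
        then have "emeasure lborel (?D i x) = ennreal (2 ^ ?n) * emeasure lborel (?D j x)"
          using l by (simp add: emeasure_dyadic_cube ennreal_mult)
        also have "\<dots> \<le> ennreal (2 ^ ?n) * (2 * emeasure lborel (E \<inter> ?D j x))"
          using j by (intro mult_left_mono) (auto simp: dense_def)
        also have "\<dots> \<le> ennreal (2 ^ ?n) * (2 * emeasure lborel (E \<inter> ?D i x))"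
          using dyadic_cube_antimono[of i j a l x] i by (intro mult_left_mono emeasure_mono) auto
        finally show ?thesis
          by (simp add: ennreal_power[symmetric] mult_ac)
      qed
      ultimately have "good (?D i x)"
        by (simp add: good_def dense_def)
      then show ?thesis
        using x by (auto simp: A_def)
    qed simp
  qed
  have "\<exists>k. good (?D k x)" if "x \<in> A" for x
    using that by (simp add: A_def)
  from dyadic_stopping_cover[of A good, OF this]
  obtain \<P> where "countable \<P> \<and> disjoint \<P> \<and> A \<subseteq> \<Union>\<P> \<and>
    (\<forall>P\<in>\<P>. good P \<and> (\<exists>k. \<exists>x\<in>A. P = ?D k x))" ..
  then have \<P>: "countable \<P>" "disjoint \<P>" "A \<subseteq> \<Union>\<P>"
    and P_good: "\<And>P. P \<in> \<P> \<Longrightarrow> good P"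
    and P_dyadic: "\<And>P. P \<in> \<P> \<Longrightarrow> \<exists>k. \<exists>x\<in>A. P = ?D k x"
    by simp_all
  have sets_P [measurable]: "P \<in> sets borel" and P_Q: "P \<subseteq> ?Q" if "P \<in> \<P>" for P
    using P_dyadic[OF that] dyadic_cube_subset_hcube[OF l] by (auto simp: A_def)
  have sets_UP [measurable]: "\<Union>\<P> \<in> sets borel"
    using \<P>(1) sets_P by auto
  have disj: "disjoint_family_on (\<lambda>P. P) \<P>"
    using \<P>(2) by (auto simp: disjoint_family_on_def disjoint_def)
  define F where "F x = kernel_energy \<delta> ?Q (indicator E) x * ennreal_powr (?M x) s" for x
  have [measurable]: "F \<in> borel_measurable borel"
    unfolding F_def by measurable
  \<comment> \<open>\<open>m\<close> below is the average of the weight over \<open>P\<close>; it is constant on \<open>P\<close>, so it may be moved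
      under the integral and there be replaced by the maximal function.\<close>
  have cube: "ennreal_powr (emeasure W P) s \<le> ?K * emeasure (density lborel F) P" if P: "P \<in> \<P>" for P
  proof -
    obtain k x0 where x0: "P = ?D k x0"
      using P_dyadic[OF P] by blast
    obtain c where c: "P = hcube c (l / 2 ^ k)"
      using dyadic_cube_eq_hcube[OF l] x0 by metis
    define r where "r = l / 2 ^ k"
    have r: "0 < r" using l by (simp add: r_def)
    have eP: "emeasure lborel P = ennreal (r ^ ?n)"
      using r by (simp add: c r_def[symmetric] emeasure_hcube)
    define m where "m = emeasure W P / emeasure lborel P"
    have m: "m \<le> ?M x" if "x \<in> P" for x
    proof -
      have "?D k x = P"
        using that dyadic_cube_eq unfolding x0 by blast
      then have "m = (\<integral>\<^sup>+ y\<in>?D k x. \<omega> y \<partial>lborel) / emeasure lborel (?D k x)"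
        using P by (simp add: m_def W)
      then show ?thesis
        unfolding dyadic_maximal_def by (auto intro: SUP_upper)
    qed
    have "emeasure W P = m * ennreal (r ^ ?n)"
      using r unfolding m_def eP by (simp add: ennreal_divide_times ennreal_divide_self mult_divide_eq_ennreal)
    then have "ennreal_powr (emeasure W P) s = ennreal_powr m s * ennreal (r powr (real ?n - \<delta>))"
      using s r by (simp add: ennreal_powr_mult ennreal_powr_ennreal powr_realpow[symmetric] powr_powr s_def)
    also have "\<dots> \<le> ennreal_powr m s * (?K * (\<integral>\<^sup>+ x\<in>P. kernel_energy \<delta> P (indicator E) x \<partial>lborel))"
      using half_filled_cube_le_energy[of E r \<delta> c] P_good[OF P] r \<delta> c
      by (intro mult_left_mono) (auto simp: good_def r_def)
    also have "\<dots> = ?K * (\<integral>\<^sup>+ x. kernel_energy \<delta> P (indicator E) x * ennreal_powr m s * indicator P x \<partial>lborel)"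
    proof -
      have "(\<integral>\<^sup>+ x. kernel_energy \<delta> P (indicator E) x * ennreal_powr m s * indicator P x \<partial>lborel)
          = ennreal_powr m s * (\<integral>\<^sup>+ x\<in>P. kernel_energy \<delta> P (indicator E) x \<partial>lborel)"
        using P by (subst nn_integral_cmult[symmetric]) (auto simp: mult_ac)
      then show ?thesis
        by (simp add: mult_ac)
    qed
    also have "\<dots> \<le> ?K * (\<integral>\<^sup>+ x. F x * indicator P x \<partial>lborel)"
    proof (intro mult_left_mono nn_integral_mono)
      fix x
      show "kernel_energy \<delta> P (indicator E) x * ennreal_powr m s * indicator P x \<le> F x * indicator P x"
        using m[of x] s kernel_energy_mono[OF P_Q[OF P]]
        by (cases "x \<in> P") (auto simp: F_def intro!: mult_mono ennreal_powr_mono)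
    qed simp
    also have "\<dots> = ?K * emeasure (density lborel F) P"
      using P by (simp add: emeasure_density)
    finally show ?thesis .
  qed
  have [measurable]: "N \<in> sets borel"
    unfolding N_def using null_set_dyadic_sparse[OF l, of E a] by (simp add: null_sets_def)
  have N: "emeasure W N = 0"
  proof -
    have "N \<in> null_sets lborel"
      unfolding N_def using l by (intro null_set_dyadic_sparse) auto
    then show ?thesis
      unfolding W_def by (subst emeasure_density) (auto simp: nn_integral_null_set null_sets_def)
  qed
  have "emeasure W (E \<inter> ?Q) \<le> emeasure W (\<Union>\<P> \<union> N)"
    using cover \<P>(3) by (intro emeasure_mono) auto
  also have "\<dots> = emeasure W (\<Union>\<P>)"
    using N by (intro emeasure_Un_null_set) (auto simp: null_sets_def)
  also have "\<dots> = (\<integral>\<^sup>+ P. emeasure W P \<partial>count_space \<P>)"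
    using emeasure_UN_countable[OF _ \<P>(1) disj, of W] by simp
  finally have "ennreal_powr (emeasure W (E \<inter> ?Q)) s \<le> ennreal_powr (\<integral>\<^sup>+ P. emeasure W P \<partial>count_space \<P>) s"
    using s by (intro ennreal_powr_mono)
  also have "\<dots> \<le> (\<integral>\<^sup>+ P. ennreal_powr (emeasure W P) s \<partial>count_space \<P>)"
    using s by (rule ennreal_powr_nn_integral_count_space_le)
  also have "\<dots> \<le> (\<integral>\<^sup>+ P. ?K * emeasure (density lborel F) P \<partial>count_space \<P>)"
    using cube by (intro nn_integral_mono) auto
  also have "\<dots> = ?K * emeasure (density lborel F) (\<Union>\<P>)"
    using emeasure_UN_countable[OF _ \<P>(1) disj, of "density lborel F"] by (simp add: nn_integral_cmult)
  also have "\<dots> \<le> ?K * emeasure (density lborel F) ?Q"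
    using P_Q by (intro mult_left_mono emeasure_mono) auto
  finally show ?thesis
    by (simp add: W emeasure_density F_def)
qed

section \<open>From level sets to functions\<close>

lemma nn_integral_power_upto:
  fixes v :: real
  assumes "1 < p"
  shows "(\<integral>\<^sup>+ t\<in>{0<..}. ennreal (p * t powr (p - 1)) * indicator {..<v} t \<partial>lborel) = ennreal (max 0 v powr p)"
proof -
  have "((\<lambda>t. t powr (p - 1)) has_integral (max 0 v powr p / p)) {0..max 0 v}"
    using has_integral_powr_from_0[of "p - 1" "max 0 v"] assms by simp
  then have "(\<integral>\<^sup>+ t. ennreal (indicator {0..max 0 v} t * t powr (p - 1)) \<partial>lborel) = ennreal (max 0 v powr p / p)"
    by (intro nn_integral_has_integral_lebesgue) auto
  then have "ennreal p * (\<integral>\<^sup>+ t. ennreal (indicator {0..max 0 v} t * t powr (p - 1)) \<partial>lborel) = ennreal (max 0 v powr p)"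
    using assms by (simp add: ennreal_mult[symmetric])
  moreover have "(\<integral>\<^sup>+ t\<in>{0<..}. ennreal (p * t powr (p - 1)) * indicator {..<v} t \<partial>lborel)
    = (\<integral>\<^sup>+ t. ennreal p * ennreal (indicator {0..max 0 v} t * t powr (p - 1)) \<partial>lborel)"
  proof (rule nn_integral_cong_AE)
    have "AE t in lborel. t \<noteq> v \<and> t \<noteq> 0"
      using AE_lborel_singleton[of v] AE_lborel_singleton[of 0] by eventually_elim simp
    then show "AE t in lborel. ennreal (p * t powr (p - 1)) * indicator {..<v} t * indicator {0<..} t
       = ennreal p * ennreal (indicator {0..max 0 v} t * t powr (p - 1))"
      by eventually_elim (use assms in \<open>auto simp: indicator_def ennreal_mult'\<close>)
  qed
  ultimately show ?thesis
    by (simp add: nn_integral_cmult)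
qed

text \<open>As \<open>\<phi>\<close> is decreasing, \<open>t \<phi>(t) \<le> \<Phi>\<close>, where \<open>\<Phi>\<close> is the integral of \<open>\<phi>\<close> over \<open>t > 0\<close>.  Hence the
  integrand \<open>p t\<^sup>p\<^sup>-\<^sup>1 \<phi>(t)\<^sup>p\<close> of the layer cake formula is at most \<open>p \<Phi>\<^sup>p\<^sup>-\<^sup>1 \<phi>(t)\<close>, and integration
  over \<open>t\<close> gives \<open>p \<Phi>\<^sup>p\<close>.  The factor \<open>p\<close> is harmless, since \<open>p\<close> to the power \<open>1 / p\<close> is
  bounded.\<close>

lemma layer_cake_bound:
  fixes v :: "'a \<Rightarrow> real"
  assumes "sigma_finite_measure M" and [measurable]: "v \<in> borel_measurable M" and p: "1 < p"
  defines "\<phi> \<equiv> \<lambda>t. ennreal_powr (emeasure M {x \<in> space M. t < v x}) (1 / p)"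
  shows "(\<integral>\<^sup>+ x. ennreal (max 0 (v x) powr p) \<partial>M)
    \<le> ennreal p * ennreal_powr (\<integral>\<^sup>+ t\<in>{0<..}. \<phi> t \<partial>lborel) p"
proof -
  interpret sigma_finite_measure M by fact
  interpret pair_sigma_finite M "lborel :: real measure" ..
  let ?\<Phi> = "\<integral>\<^sup>+ t\<in>{0<..}. \<phi> t \<partial>lborel"
  have [measurable]: "\<phi> \<in> borel_measurable borel"
    unfolding \<phi>_def by measurable
  have \<phi>_mono: "\<phi> t \<le> \<phi> r" if "r \<le> t" for r t
    unfolding \<phi>_def using that p by (intro ennreal_powr_mono emeasure_mono) auto
  have Chebyshev: "ennreal t * \<phi> t \<le> ?\<Phi>" if "0 < t" for t
  proof -
    have "ennreal t * \<phi> t = (\<integral>\<^sup>+ r. \<phi> t * indicator {0<..<t} r \<partial>lborel)"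
      using that by (simp add: nn_integral_cmult mult.commute)
    also have "\<dots> \<le> ?\<Phi>"
      using \<phi>_mono by (intro nn_integral_mono) (auto simp: indicator_def)
    finally show ?thesis .
  qed
  have slice: "ennreal (p * t powr (p - 1)) * emeasure M {x \<in> space M. t < v x}
      \<le> ennreal p * ennreal_powr ?\<Phi> (p - 1) * \<phi> t" if t: "0 < t" for t
  proof -
    have "emeasure M {x \<in> space M. t < v x} = ennreal_powr (\<phi> t) ((p - 1) + 1)"
      using p by (simp add: \<phi>_def ennreal_powr_powr ennreal_powr_one)
    also have "\<dots> = ennreal_powr (\<phi> t) (p - 1) * \<phi> t"
      by (simp only: ennreal_powr_add ennreal_powr_one)
    finally have "ennreal (p * t powr (p - 1)) * emeasure M {x \<in> space M. t < v x}
      = ennreal p * (ennreal_powr (ennreal t * \<phi> t) (p - 1) * \<phi> t)"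
      using p t by (simp add: ennreal_powr_mult ennreal_powr_ennreal ennreal_mult mult_ac)
    also have "\<dots> \<le> ennreal p * (ennreal_powr ?\<Phi> (p - 1) * \<phi> t)"
      using p t Chebyshev by (intro mult_left_mono mult_right_mono ennreal_powr_mono) auto
    finally show ?thesis by (simp add: mult.assoc)
  qed
  have "(\<integral>\<^sup>+ x. ennreal (max 0 (v x) powr p) \<partial>M)
    = (\<integral>\<^sup>+ x. \<integral>\<^sup>+ t. ennreal (p * t powr (p - 1)) * (if t < v x then 1 else 0) * indicator {0<..} t \<partial>lborel \<partial>M)"
    using p by (simp add: nn_integral_power_upto[symmetric] indicator_def of_bool_def)
  also have "\<dots> = (\<integral>\<^sup>+ t. \<integral>\<^sup>+ x. ennreal (p * t powr (p - 1)) * (if t < v x then 1 else 0) * indicator {0<..} t \<partial>M \<partial>lborel)"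
    by (rule Fubini'[symmetric]) measurable
  also have "\<dots> = (\<integral>\<^sup>+ t\<in>{0<..}. ennreal (p * t powr (p - 1)) * emeasure M {x \<in> space M. t < v x} \<partial>lborel)"
  proof (rule nn_integral_cong)
    fix t :: real
    have "(\<integral>\<^sup>+ x. (if t < v x then 1 else 0) \<partial>M) = (\<integral>\<^sup>+ x. indicator {x \<in> space M. t < v x} x \<partial>M)"
      by (intro nn_integral_cong) (auto simp: indicator_def)
    then show "(\<integral>\<^sup>+ x. ennreal (p * t powr (p - 1)) * (if t < v x then 1 else 0) * indicator {0<..} t \<partial>M)
      = ennreal (p * t powr (p - 1)) * emeasure M {x \<in> space M. t < v x} * indicator {0<..} t"
      by (simp add: nn_integral_cmult nn_integral_multc)
  qed
  also have "\<dots> \<le> (\<integral>\<^sup>+ t. ennreal p * ennreal_powr ?\<Phi> (p - 1) * (\<phi> t * indicator {0<..} t) \<partial>lborel)"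
    using slice by (intro nn_integral_mono) (auto simp: indicator_def)
  also have "\<dots> = ennreal p * (ennreal_powr ?\<Phi> (p - 1) * ?\<Phi>)"
    by (simp add: nn_integral_cmult mult.assoc)
  also have "ennreal_powr ?\<Phi> (p - 1) * ?\<Phi> = ennreal_powr ?\<Phi> p"
    using ennreal_powr_add[of ?\<Phi> "p - 1" 1] by (simp add: ennreal_powr_one)
  finally show ?thesis .
qed

lemma coarea_abs_diff:
  fixes a b :: real
  shows "(\<integral>\<^sup>+ t. ennreal \<bar>indicator {..<a} t - indicator {..<b} t\<bar> \<partial>lborel) = ennreal \<bar>a - b\<bar>"
proof -
  have *: "(\<integral>\<^sup>+ t. ennreal \<bar>indicator {..<a} t - indicator {..<b} t\<bar> \<partial>lborel) = ennreal \<bar>a - b\<bar>"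
    if "a \<le> b" for a b :: real
  proof -
    have "(\<integral>\<^sup>+ t. ennreal \<bar>indicator {..<a} t - indicator {..<b} t\<bar> \<partial>lborel)
      = (\<integral>\<^sup>+ t. indicator {a..<b} t \<partial>lborel)"
      using that by (intro nn_integral_cong) (auto simp: indicator_def)
    then show ?thesis using that by simp
  qed
  show ?thesis
    using *[of a b] *[of b a] by (cases "a \<le> b") (simp_all add: abs_minus_commute)
qed

text \<open>Coarea formula: for fixed \<open>x\<close> and \<open>y\<close>, the levels \<open>t\<close> that separate \<open>v x\<close> from \<open>v y\<close> form an
  interval of length \<open>\<bar>v x - v y\<bar>\<close>.\<close>

lemma kernel_energy_coarea:
  fixes v :: "real ^ 'n \<Rightarrow> real"
  assumes [measurable]: "v \<in> borel_measurable borel" "Q \<in> sets borel"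
  shows "(\<integral>\<^sup>+ t. kernel_energy \<delta> Q (indicator {z. t < v z}) x \<partial>lborel) = kernel_energy \<delta> Q v x"
proof -
  define k where "k y = norm (x - y) powr (real CARD('n) + \<delta>)" for y
  have [measurable]: "k \<in> borel_measurable borel"
    unfolding k_def by measurable
  have "(\<integral>\<^sup>+ t. kernel_energy \<delta> Q (indicator {z. t < v z}) x \<partial>lborel)
    = (\<integral>\<^sup>+ t. \<integral>\<^sup>+ y. ennreal (\<bar>(if t < v x then 1 else 0) - (if t < v y then 1 else 0)\<bar> / k y) * indicator Q y \<partial>lborel \<partial>lborel)"
    by (simp add: kernel_energy_def k_def indicator_def of_bool_def)
  also have "\<dots> = (\<integral>\<^sup>+ y. \<integral>\<^sup>+ t. ennreal (\<bar>(if t < v x then 1 else 0) - (if t < v y then 1 else 0)\<bar> / k y) * indicator Q y \<partial>lborel \<partial>lborel)"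
    by (rule nn_integral_lborel_swap) (simp add: borel_prod[symmetric])
  also have "\<dots> = kernel_energy \<delta> Q v x"
    unfolding kernel_energy_def
  proof (rule nn_integral_cong)
    fix y
    have "(\<integral>\<^sup>+ t. ennreal (\<bar>(if t < v x then 1 else 0) - (if t < v y then 1 else 0)\<bar> / k y) * indicator Q y \<partial>lborel)
      = (\<integral>\<^sup>+ t. ennreal (1 / k y) * indicator Q y * ennreal \<bar>indicator {..<v x} t - indicator {..<v y} t\<bar> \<partial>lborel)"
      by (intro nn_integral_cong) (auto simp: indicator_def k_def ennreal_mult'[symmetric])
    also have "\<dots> = ennreal (1 / k y) * indicator Q y * ennreal \<bar>v x - v y\<bar>"
      by (simp add: nn_integral_cmult coarea_abs_diff)
    also have "\<dots> = ennreal (\<bar>v x - v y\<bar> / norm (x - y) powr (real CARD('n) + \<delta>)) * indicator Q y"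
      by (auto simp: indicator_def k_def ennreal_mult'[symmetric])
    finally show "(\<integral>\<^sup>+ t. ennreal (\<bar>(if t < v x then 1 else 0) - (if t < v y then 1 else 0)\<bar> / k y) * indicator Q y \<partial>lborel)
      = ennreal (\<bar>v x - v y\<bar> / norm (x - y) powr (real CARD('n) + \<delta>)) * indicator Q y" .
  qed
  finally show ?thesis .
qed

text \<open>The level sets \<open>{v > t}\<close> with \<open>t > 0\<close> fill at most half of the cube, so the isoperimetric
  inequality applies to each of them; integration over \<open>t\<close> turns their energies into that of
  \<open>v\<close> by the coarea formula, and their measures into a norm of the positive part of \<open>v\<close> by the
  layer cake bound.\<close>

lemma positive_part_bound:
  fixes a :: "real ^ 'n" and v :: "real ^ 'n \<Rightarrow> real" and \<delta> :: real
  assumes [measurable]: "v \<in> borel_measurable borel" "\<omega> \<in> borel_measurable borel"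
    and fin: "AE x in lborel. \<omega> x \<noteq> \<infinity>"
    and l: "0 < l" and \<delta>: "0 < \<delta>" "\<delta> < 1"
    and half: "2 * emeasure lborel {x \<in> hcube a l. 0 < v x} \<le> emeasure lborel (hcube a l)"
  defines "p \<equiv> CARD('n) / (CARD('n) - \<delta>)"
  shows "(\<integral>\<^sup>+ x\<in>hcube a l. ennreal (max 0 (v x) powr p) * \<omega> x \<partial>lborel)
    \<le> ennreal p * ennreal_powr (ennreal (iso_const TYPE('n) \<delta>) *
    (\<integral>\<^sup>+ x\<in>hcube a l. kernel_energy \<delta> (hcube a l) v x * ennreal_powr (dyadic_maximal a l \<omega> x) (1 / p) \<partial>lborel)) p"
proof -
  let ?Q = "hcube a l" and ?K = "ennreal (iso_const TYPE('n) \<delta>)"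
  define m where "m x = ennreal_powr (dyadic_maximal a l \<omega> x) (1 / p) * indicator ?Q x" for x
  note [measurable] = measurable_dyadic_maximal[OF assms(2) l]
  have [measurable]: "m \<in> borel_measurable borel"
    unfolding m_def by measurable
  have "\<delta> < real CARD('n)"
    using \<delta> by (intro less_card)
  then have p: "1 < p" and s: "(CARD('n) - \<delta>) / CARD('n) = 1 / p"
    using \<delta> by (auto simp: p_def field_simps)
  define M where "M = density lborel (\<lambda>x. \<omega> x * indicator ?Q x)"
  have M: "sigma_finite_measure M"
    unfolding M_def
    by (subst sigma_finite_measure.sigma_finite_iff_density_finite[OF sigma_finite_lborel])
       (use fin in \<open>auto elim!: eventually_mono simp: indicator_def\<close>)
  have vM: "v \<in> borel_measurable M"
    by (simp add: M_def)
  define E where "E t = {x. t < v x}" for t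
  have [measurable]: "E t \<in> sets borel" for t
    unfolding E_def by measurable
  have level: "ennreal_powr (emeasure M {x \<in> space M. t < v x}) (1 / p)
     \<le> ?K * (\<integral>\<^sup>+ x. kernel_energy \<delta> ?Q (indicator {z. t < v z}) x * m x \<partial>lborel)" if t: "0 < t" for t
  proof -
    have "emeasure lborel (E t \<inter> ?Q) \<le> emeasure lborel {x \<in> ?Q. 0 < v x}"
      using t by (intro emeasure_mono) (auto simp: E_def)
    then have "2 * emeasure lborel (E t \<inter> ?Q) \<le> 2 * emeasure lborel {x \<in> ?Q. 0 < v x}"
      by (intro mult_left_mono) auto
    also note half
    finally have "ennreal_powr (\<integral>\<^sup>+ x\<in>E t \<inter> ?Q. \<omega> x \<partial>lborel) (1 / p) \<le> ?K *
      (\<integral>\<^sup>+ x\<in>?Q. kernel_energy \<delta> ?Q (indicator (E t)) x * ennreal_powr (dyadic_maximal a l \<omega> x) (1 / p) \<partial>lborel)"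
      using weighted_isoperimetric[of "E t" \<omega> l \<delta> a] l \<delta> by (simp add: s)
    moreover have "emeasure M {x \<in> space M. t < v x} = (\<integral>\<^sup>+ x\<in>E t \<inter> ?Q. \<omega> x \<partial>lborel)"
      unfolding E_def[symmetric] M_def
      by (simp add: emeasure_density E_def[symmetric] indicator_inter_arith mult_ac)
    ultimately show ?thesis
      by (simp add: m_def E_def mult.assoc)
  qed
  have [measurable]: "(\<lambda>(t, x). kernel_energy \<delta> ?Q (indicator {z. t < v z}) x) \<in> borel_measurable (borel \<Otimes>\<^sub>M borel)"
    unfolding kernel_energy_def indicator_def by measurable
  have "(\<integral>\<^sup>+ t\<in>{0<..}. ennreal_powr (emeasure M {x \<in> space M. t < v x}) (1 / p) \<partial>lborel)
    \<le> (\<integral>\<^sup>+ t. ?K * (\<integral>\<^sup>+ x. kernel_energy \<delta> ?Q (indicator {z. t < v z}) x * m x \<partial>lborel) \<partial>lborel)"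
    using level by (intro nn_integral_mono) (auto simp: indicator_def)
  also have "\<dots> = ?K * (\<integral>\<^sup>+ t. \<integral>\<^sup>+ x. kernel_energy \<delta> ?Q (indicator {z. t < v z}) x * m x \<partial>lborel \<partial>lborel)"
    by (rule nn_integral_cmult) measurable
  also have "(\<integral>\<^sup>+ t. \<integral>\<^sup>+ x. kernel_energy \<delta> ?Q (indicator {z. t < v z}) x * m x \<partial>lborel \<partial>lborel)
    = (\<integral>\<^sup>+ x. \<integral>\<^sup>+ t. kernel_energy \<delta> ?Q (indicator {z. t < v z}) x * m x \<partial>lborel \<partial>lborel)"
    by (rule nn_integral_lborel_swap) (simp add: borel_prod[symmetric])
  also have "\<dots> = (\<integral>\<^sup>+ x. kernel_energy \<delta> ?Q v x * m x \<partial>lborel)"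
    by (simp add: nn_integral_multc kernel_energy_coarea)
  finally have \<Phi>: "(\<integral>\<^sup>+ t\<in>{0<..}. ennreal_powr (emeasure M {x \<in> space M. t < v x}) (1 / p) \<partial>lborel)
    \<le> ?K * (\<integral>\<^sup>+ x. kernel_energy \<delta> ?Q v x * m x \<partial>lborel)" .
  have "(\<integral>\<^sup>+ x\<in>?Q. ennreal (max 0 (v x) powr p) * \<omega> x \<partial>lborel) = (\<integral>\<^sup>+ x. ennreal (max 0 (v x) powr p) \<partial>M)"
    unfolding M_def by (subst nn_integral_density) (auto simp: mult_ac)
  also have "\<dots> \<le> ennreal p * ennreal_powr
      (\<integral>\<^sup>+ t\<in>{0<..}. ennreal_powr (emeasure M {x \<in> space M. t < v x}) (1 / p) \<partial>lborel) p"
    by (rule layer_cake_bound[OF M vM p])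
  also have "\<dots> \<le> ennreal p * ennreal_powr (?K * (\<integral>\<^sup>+ x. kernel_energy \<delta> ?Q v x * m x \<partial>lborel)) p"
    using p by (intro mult_left_mono ennreal_powr_mono \<Phi>) auto
  finally show ?thesis
    by (simp add: m_def mult.assoc)
qed

text \<open>The infimum \<open>m\<close> of the \<open>t\<close> for which \<open>{u > t}\<close> has at most half of the total measure is a
  median: \<open>{u > m}\<close> and \<open>{u < m}\<close> are increasing unions of sets \<open>{u > m + e\<^sub>n}\<close> and
  \<open>{u \<le> m - e\<^sub>n}\<close> that have at most half of it, where \<open>e\<^sub>n\<close> decreases to \<open>0\<close>.\<close>

lemma (in finite_measure) median_exists:
  assumes [measurable]: "u \<in> borel_measurable M"
  obtains m :: real where "2 * measure M {x \<in> space M. m < u x} \<le> measure M (space M)"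
    "2 * measure M {x \<in> space M. u x < m} \<le> measure M (space M)"
proof (cases "measure M (space M) = 0")
  case True
  then show thesis
    using that[of 0] bounded_measure by (metis measure_le_0_iff mult_zero_right order_refl)
next
  case False
  let ?\<mu> = "measure M (space M)"
  define F where "F t = measure M {x \<in> space M. t < u x}" for t
  have pos: "0 < ?\<mu>"
    using False by (simp add: less_le)
  have anti: "F t \<le> F r" if "r \<le> t" for r t
    unfolding F_def using that by (intro finite_measure_mono) auto
  have "(\<lambda>n. F (real n)) \<longlonglongrightarrow> measure M (\<Inter>n. {x \<in> space M. real n < u x})"
    unfolding F_def by (intro finite_Lim_measure_decseq) (auto simp: decseq_def)
  moreover have "(\<Inter>n. {x \<in> space M. real n < u x}) = {}"
    by auto (metis less_asym reals_Archimedean2)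
  ultimately have "(\<lambda>n. F (real n)) \<longlonglongrightarrow> 0"
    by simp
  then have "\<forall>\<^sub>F n in sequentially. F (real n) < ?\<mu> / 2"
    using pos by (intro order_tendstoD) auto
  then obtain n1 where n1: "F (real n1) < ?\<mu> / 2"
    by (auto simp: eventually_sequentially)
  have "(\<lambda>n. F (- real n)) \<longlonglongrightarrow> measure M (\<Union>n. {x \<in> space M. - real n < u x})"
    unfolding F_def by (intro finite_Lim_measure_incseq) (auto simp: incseq_def)
  moreover have "(\<Union>n. {x \<in> space M. - real n < u x}) = space M"
    by auto (metis minus_less_iff reals_Archimedean2)
  ultimately have "(\<lambda>n. F (- real n)) \<longlonglongrightarrow> ?\<mu>"
    by simp
  then have "\<forall>\<^sub>F n in sequentially. ?\<mu> / 2 < F (- real n)"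
    using pos by (intro order_tendstoD) auto
  then obtain n2 where n2: "?\<mu> / 2 < F (- real n2)"
    by (auto simp: eventually_sequentially)
  define T where "T = {t. 2 * F t \<le> ?\<mu>}"
  define m where "m = Inf T"
  have ne: "T \<noteq> {}"
    using n1 by (auto simp: T_def intro!: exI[of _ "real n1"])
  have bdd: "bdd_below T"
  proof (rule bdd_belowI)
    fix t assume "t \<in> T"
    then have "F t < F (- real n2)"
      using n2 by (simp add: T_def)
    then show "- real n2 \<le> t"
      using anti[of t "- real n2"] by linarith
  qed
  define e where "e n = 1 / (real n + 1)" for n
  have e: "0 < e n" for n by (simp add: e_def)
  have e0: "\<exists>n. e n < d" if "0 < d" for d
    using reals_Archimedean[OF that] by (simp add: e_def inverse_eq_divide add.commute)
  have e_mono: "e n \<le> e k" if "k \<le> n" for k n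
    using that by (simp add: e_def frac_le)
  have above: "2 * F (m + e n) \<le> ?\<mu>" for n
  proof -
    obtain t where "t \<in> T" "t < m + e n"
      using cInf_lessD[OF ne, of "m + e n"] e by (auto simp: m_def)
    then show ?thesis
      using anti[of t "m + e n"] by (simp add: T_def)
  qed
  have below: "?\<mu> < 2 * F (m - e n)" for n
  proof (rule ccontr)
    assume "\<not> ?\<mu> < 2 * F (m - e n)"
    then have "m \<le> m - e n"
      unfolding m_def by (intro cInf_lower bdd) (auto simp: T_def m_def)
    with e[of n] show False by simp
  qed
  have "(\<lambda>n. F (m + e n)) \<longlonglongrightarrow> measure M (\<Union>n. {x \<in> space M. m + e n < u x})"
    unfolding F_def using e_mono by (intro finite_Lim_measure_incseq) (auto simp: incseq_def, fastforce)
  moreover have "(\<Union>n. {x \<in> space M. m + e n < u x}) = {x \<in> space M. m < u x}"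
  proof safe
    fix x n assume "m + e n < u x" then show "m < u x" using e[of n] by simp
  next
    fix x assume x: "x \<in> space M" "m < u x"
    then obtain n where "e n < u x - m" using e0[of "u x - m"] by auto
    then show "x \<in> (\<Union>n. {x \<in> space M. m + e n < u x})" using x by (auto intro!: exI[of _ n])
  qed
  ultimately have lim: "(\<lambda>n. F (m + e n)) \<longlonglongrightarrow> measure M {x \<in> space M. m < u x}"
    by simp
  have 1: "measure M {x \<in> space M. m < u x} \<le> ?\<mu> / 2"
    by (rule LIMSEQ_le_const2[OF lim]) (use above in \<open>auto simp: field_simps\<close>)
  have "(\<lambda>n. measure M {x \<in> space M. u x \<le> m - e n}) \<longlonglongrightarrow> measure M (\<Union>n. {x \<in> space M. u x \<le> m - e n})"
    using e_mono by (intro finite_Lim_measure_incseq) (auto simp: incseq_def, fastforce)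
  moreover have "(\<Union>n. {x \<in> space M. u x \<le> m - e n}) = {x \<in> space M. u x < m}"
  proof safe
    fix x n assume "u x \<le> m - e n" then show "u x < m" using e[of n] by simp
  next
    fix x assume x: "x \<in> space M" "u x < m"
    then obtain n where "e n < m - u x" using e0[of "m - u x"] by auto
    then show "x \<in> (\<Union>n. {x \<in> space M. u x \<le> m - e n})" using x by (auto intro!: exI[of _ n])
  qed
  ultimately have lim2: "(\<lambda>n. measure M {x \<in> space M. u x \<le> m - e n}) \<longlonglongrightarrow> measure M {x \<in> space M. u x < m}"
    by simp
  have "measure M {x \<in> space M. u x \<le> m - e n} \<le> ?\<mu> / 2" for n
  proof -
    have "measure M {x \<in> space M. u x \<le> m - e n} = ?\<mu> - F (m - e n)"
      unfolding F_def by (subst finite_measure_compl[symmetric]) (auto intro!: arg_cong[where f="measure M"])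
    then show ?thesis using below[of n] by simp
  qed
  then have 2: "measure M {x \<in> space M. u x < m} \<le> ?\<mu> / 2"
    by (intro LIMSEQ_le_const2[OF lim2]) auto
  show thesis
    using that[of m] 1 2 by simp
qed

text \<open>With \<open>m\<close> a median of \<open>u\<close>, the bound for positive parts applies to \<open>u - m\<close> and to \<open>m - u\<close>.  The
  resulting factor \<open>2 p\<close> enters with the exponent \<open>1 / p\<close>, and \<open>2 p \<le> exp (2 p)\<close> gives the bound
  \<open>exp 2\<close> for it, uniformly in \<open>\<delta>\<close>.\<close>

lemma weighted_poincare_half_open:
  fixes a :: "real ^ 'n" and u :: "real ^ 'n \<Rightarrow> real" and \<delta> :: real
  assumes [measurable]: "u \<in> borel_measurable borel" "\<omega> \<in> borel_measurable borel"
    and fin: "AE x in lborel. \<omega> x \<noteq> \<infinity>"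
    and l: "0 < l" and \<delta>: "0 < \<delta>" "\<delta> < 1"
  defines "p \<equiv> CARD('n) / (CARD('n) - \<delta>)"
  obtains m where "ennreal_powr (\<integral>\<^sup>+ x\<in>hcube a l. ennreal (\<bar>u x - m\<bar> powr p) * \<omega> x \<partial>lborel) (1 / p)
    \<le> ennreal (exp 2 * iso_const TYPE('n) \<delta>) *
    (\<integral>\<^sup>+ x\<in>hcube a l. kernel_energy \<delta> (hcube a l) u x * ennreal_powr (dyadic_maximal a l \<omega> x) (1 / p) \<partial>lborel)"
proof -
  let ?Q = "hcube a l" and ?K = "ennreal (iso_const TYPE('n) \<delta>)"
  let ?J = "\<lambda>v. \<integral>\<^sup>+ x\<in>?Q. kernel_energy \<delta> ?Q v x * ennreal_powr (dyadic_maximal a l \<omega> x) (1 / p) \<partial>lborel"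
  have "\<delta> < real CARD('n)"
    using \<delta> by (intro less_card)
  then have p: "1 < p"
    using \<delta> by (auto simp: p_def field_simps)
  have fQ: "emeasure lborel ?Q \<noteq> \<infinity>"
    using l by (simp add: emeasure_hcube)
  define M where "M = restrict_space lborel ?Q"
  interpret M: finite_measure M
    using fQ by (intro finite_measureI) (simp add: M_def emeasure_restrict_space space_restrict_space)
  have "u \<in> borel_measurable M"
    unfolding M_def by (intro measurable_restrict_space1) simp
  then obtain m where m: "2 * measure M {x \<in> space M. m < u x} \<le> measure M (space M)"
    "2 * measure M {x \<in> space M. u x < m} \<le> measure M (space M)"
    by (rule M.median_exists)
  have eM: "2 * emeasure lborel {x \<in> ?Q. R x} \<le> emeasure lborel ?Q"
    if "2 * measure M {x \<in> space M. R x} \<le> measure M (space M)" "{x. R x} \<in> sets borel" for R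
  proof -
    have "{x \<in> ?Q. R x} = ?Q \<inter> {x. R x}" by auto
    then have [measurable]: "{x \<in> ?Q. R x} \<in> sets borel"
      using that(2) by auto
    have "emeasure lborel {x \<in> ?Q. R x} = emeasure M {x \<in> space M. R x}"
      by (simp add: M_def space_restrict_space emeasure_restrict_space)
    moreover have "emeasure lborel ?Q = emeasure M (space M)"
      by (simp add: M_def space_restrict_space emeasure_restrict_space)
    ultimately show ?thesis
      using that(1) by (simp add: M.emeasure_eq_measure ennreal_mult[symmetric] flip: ennreal_numeral)
  qed
  have split: "\<bar>u x - m\<bar> powr p = max 0 (u x - m) powr p + max 0 (m - u x) powr p" for x
    using p by (auto simp: max_def)
  have J: "?J (\<lambda>x. u x - m) = ?J u" "?J (\<lambda>x. m - u x) = ?J u"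
    by (simp_all add: kernel_energy_def abs_minus_commute)
  have "(\<integral>\<^sup>+ x\<in>?Q. ennreal (\<bar>u x - m\<bar> powr p) * \<omega> x \<partial>lborel)
    = (\<integral>\<^sup>+ x\<in>?Q. ennreal (max 0 (u x - m) powr p) * \<omega> x \<partial>lborel)
    + (\<integral>\<^sup>+ x\<in>?Q. ennreal (max 0 (m - u x) powr p) * \<omega> x \<partial>lborel)"
    by (subst nn_integral_add[symmetric]) (auto simp: split distrib_right)
  also have "\<dots> \<le> ennreal p * ennreal_powr (?K * ?J (\<lambda>x. u x - m)) p + ennreal p * ennreal_powr (?K * ?J (\<lambda>x. m - u x)) p"
    unfolding p_def by (intro add_mono positive_part_bound fin l \<delta>) (use eM[OF m(1)] eM[OF m(2)] in auto)
  also have "\<dots> = ennreal (2 * p) * ennreal_powr (?K * ?J u) p"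
    using p unfolding J by (simp add: ennreal_mult mult_2[symmetric] mult.assoc)
  finally have "ennreal_powr (\<integral>\<^sup>+ x\<in>?Q. ennreal (\<bar>u x - m\<bar> powr p) * \<omega> x \<partial>lborel) (1 / p)
    \<le> ennreal_powr (ennreal (2 * p) * ennreal_powr (?K * ?J u) p) (1 / p)"
    using p by (intro ennreal_powr_mono) auto
  also have "\<dots> = ennreal ((2 * p) powr (1 / p)) * (?K * ?J u)"
    using p by (simp add: ennreal_powr_mult ennreal_powr_powr ennreal_powr_one ennreal_powr_ennreal)
  also have "\<dots> \<le> ennreal (exp 2) * (?K * ?J u)"
  proof (intro mult_right_mono ennreal_leI)
    have "2 * p \<le> exp (2 * p)"
      using exp_ge_add_one_self[of "2 * p"] by linarith
    then have "(2 * p) powr (1 / p) \<le> exp (2 * p) powr (1 / p)"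
      using p by (intro powr_mono2) auto
    also have "\<dots> = exp 2"
      using p by (simp add: powr_def)
    finally show "(2 * p) powr (1 / p) \<le> exp 2" .
  qed simp
  also have "\<dots> = ennreal (exp 2 * iso_const TYPE('n) \<delta>) * ?J u"
    by (simp add: ennreal_mult' mult.assoc)
  finally show thesis
    by (rule that)
qed

section \<open>Arbitrary cubes and Lebesgue measurable functions\<close>

text \<open>A locally integrable function is the pointwise limit of its restrictions to growing balls.\<close>

lemma locally_integrable_borel_measurable:
  fixes f :: "real ^ 'n \<Rightarrow> real"
  assumes "locally_integrable f"
  shows "f \<in> borel_measurable lebesgue"
proof (rule borel_measurable_LIMSEQ_real)
  fix x :: "real ^ 'n"
  obtain N :: nat where N: "norm x \<le> real N"
    using real_arch_simple by blast
  show "(\<lambda>k. indicator (cball 0 (real k)) x *\<^sub>R f x) \<longlonglongrightarrow> f x"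
    by (intro tendsto_eventually eventually_sequentiallyI[of N]) (use N in \<open>simp add: indicator_def\<close>)
next
  fix k
  have "f absolutely_integrable_on cball 0 (real k)"
    using assms by (simp add: locally_integrable_def)
  then show "(\<lambda>x. indicator (cball 0 (real k)) x *\<^sub>R f x) \<in> borel_measurable lebesgue"
    unfolding set_integrable_def by (rule borel_measurable_integrable)
qed

lemma dyadic_maximal_le_maximal_function:
  fixes w w' :: "real ^ 'n \<Rightarrow> real"
  assumes "AE y in lborel. w y = w' y" and l: "0 < l"
  shows "dyadic_maximal a l (\<lambda>y. ennreal (w' y)) x \<le> maximal_function w x"
  unfolding dyadic_maximal_def
proof (rule SUP_least)
  fix k
  let ?D = "dyadic_cube a l k x"
  obtain c where c: "?D = hcube c (l / 2 ^ k)"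
    using dyadic_cube_eq_hcube[OF l] by blast
  have "is_cube ?D"
    unfolding c using l by (intro is_cube_hcube) simp
  then have "(\<integral>\<^sup>+ y\<in>?D. ennreal \<bar>w y\<bar> \<partial>lebesgue) / emeasure lebesgue ?D \<le> maximal_function w x"
    unfolding maximal_function_def by (intro SUP_upper) simp
  moreover have "emeasure lebesgue ?D = emeasure lborel ?D"
    by simp
  moreover have "(\<integral>\<^sup>+ y\<in>?D. ennreal (w' y) \<partial>lborel) \<le> (\<integral>\<^sup>+ y\<in>?D. ennreal \<bar>w y\<bar> \<partial>lebesgue)"
    unfolding nn_integral_completion
  proof (rule nn_integral_mono_AE)
    show "AE y in lborel. ennreal (w' y) * indicator ?D y \<le> ennreal \<bar>w y\<bar> * indicator ?D y"
      using assms(1) by eventually_elim (auto simp: indicator_def intro!: ennreal_leI)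
  qed
  ultimately show "(\<integral>\<^sup>+ y\<in>?D. ennreal (w' y) \<partial>lborel) / emeasure lborel ?D \<le> maximal_function w x"
    by (simp only: order_trans[OF divide_right_mono_ennreal])
qed

text \<open>Modulo null sets, \<open>Q\<close> is half-open and \<open>u\<close> and \<open>w\<close> are Borel measurable.  These changes do not
  affect the integrals, and the maximal function only has to be bounded from below by the dyadic
  one, as dyadic cubes are cubes.\<close>

theorem theorem2p10:
  shows "\<exists>c>0. \<forall>(w :: real ^ 'n \<Rightarrow> real) (\<delta> :: real) (Q :: (real ^ 'n) set) (u :: real ^ 'n \<Rightarrow> real).
    weight w \<longrightarrow> 1/2 \<le> \<delta> \<longrightarrow> \<delta> < 1 \<longrightarrow> is_cube Q \<longrightarrow> locally_integrable u \<longrightarrow>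
    (INF k :: real.
       ennreal_powr
         (\<integral>\<^sup>+ x\<in>Q. ennreal (\<bar>u x - k\<bar> powr (CARD('n) / (CARD('n) - \<delta>)) * w x) \<partial>lebesgue)
         ((CARD('n) - \<delta>) / CARD('n)))
    \<le> ennreal (c * (1 - \<delta>)) *
       (\<integral>\<^sup>+ x\<in>Q.
          (\<integral>\<^sup>+ y\<in>Q. ennreal (\<bar>u x - u y\<bar> / norm (x - y) powr (CARD('n) + \<delta>)) \<partial>lebesgue) *
          ennreal_powr (maximal_function w x) ((CARD('n) - \<delta>) / CARD('n)) \<partial>lebesgue)"
proof -
  define C where "C = exp 2 * (2 ^ (CARD('n) + 3) * real CARD('n) ^ (CARD('n) + 1))"
  show ?thesis
  proof (intro exI[of _ C] conjI allI impI)
    show "0 < C"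
      by (simp add: C_def)
    fix w u :: "real ^ 'n \<Rightarrow> real" and \<delta> :: real and Q :: "(real ^ 'n) set"
    assume w: "weight w" and \<delta>: "1/2 \<le> \<delta>" "\<delta> < 1" and Q: "is_cube Q" and u: "locally_integrable u"
    define p where "p = CARD('n) / (CARD('n) - \<delta>)"
    have s: "(CARD('n) - \<delta>) / CARD('n) = 1 / p"
      by (simp add: p_def)
    have "\<delta> < real CARD('n)"
      using \<delta> by (intro less_card)
    then have "0 < p"
      by (simp add: p_def)
    have C: "C * (1 - \<delta>) = exp 2 * iso_const TYPE('n) \<delta>"
      by (simp add: C_def iso_const_def)
    obtain u' where [measurable]: "u' \<in> borel_measurable borel" and u': "AE x in lborel. u x = u' x"
      using completion_ex_borel_measurable_real[OF locally_integrable_borel_measurable[OF u]] by auto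
    have "locally_integrable w"
      using w by (simp add: weight_def)
    then obtain w' where [measurable]: "w' \<in> borel_measurable borel" and w': "AE x in lborel. w x = w' x"
      using completion_ex_borel_measurable_real[OF locally_integrable_borel_measurable] by auto
    obtain a l where l: "0 < l" and Qa: "AE x in lborel. x \<in> Q \<longleftrightarrow> x \<in> hcube a l"
      using is_cube_AE_eq_hcube[OF Q] .
    let ?\<omega> = "\<lambda>x. ennreal (w' x)"
    obtain m where m: "ennreal_powr (\<integral>\<^sup>+ x\<in>hcube a l. ennreal (\<bar>u' x - m\<bar> powr p) * ?\<omega> x \<partial>lborel) (1 / p)
      \<le> ennreal (exp 2 * iso_const TYPE('n) \<delta>) *
      (\<integral>\<^sup>+ x\<in>hcube a l. kernel_energy \<delta> (hcube a l) u' x * ennreal_powr (dyadic_maximal a l ?\<omega> x) (1 / p) \<partial>lborel)"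
      unfolding p_def by (rule weighted_poincare_half_open[of u' ?\<omega> l \<delta> a]) (use l \<delta> in auto)
    have lhs: "(\<integral>\<^sup>+ x\<in>Q. ennreal (\<bar>u x - m\<bar> powr p * w x) \<partial>lebesgue)
      = (\<integral>\<^sup>+ x\<in>hcube a l. ennreal (\<bar>u' x - m\<bar> powr p) * ?\<omega> x \<partial>lborel)"
      unfolding nn_integral_completion
    proof (rule nn_integral_cong_AE)
      show "AE x in lborel. ennreal (\<bar>u x - m\<bar> powr p * w x) * indicator Q x
          = ennreal (\<bar>u' x - m\<bar> powr p) * ?\<omega> x * indicator (hcube a l) x"
        using u' w' Qa by eventually_elim (simp add: ennreal_mult' indicator_def)
    qed
    have inner: "(\<integral>\<^sup>+ y\<in>Q. ennreal (\<bar>u x - u y\<bar> / norm (x - y) powr (CARD('n) + \<delta>)) \<partial>lebesgue)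
      = kernel_energy \<delta> (hcube a l) u' x" if "u x = u' x" for x
      unfolding nn_integral_completion kernel_energy_def
    proof (rule nn_integral_cong_AE)
      show "AE y in lborel. ennreal (\<bar>u x - u y\<bar> / norm (x - y) powr (CARD('n) + \<delta>)) * indicator Q y
          = ennreal (\<bar>u' x - u' y\<bar> / norm (x - y) powr (CARD('n) + \<delta>)) * indicator (hcube a l) y"
        using u' Qa by eventually_elim (simp add: that indicator_def)
    qed
    have rhs: "(\<integral>\<^sup>+ x\<in>hcube a l. kernel_energy \<delta> (hcube a l) u' x * ennreal_powr (dyadic_maximal a l ?\<omega> x) (1 / p) \<partial>lborel)
      \<le> (\<integral>\<^sup>+ x\<in>Q.
          (\<integral>\<^sup>+ y\<in>Q. ennreal (\<bar>u x - u y\<bar> / norm (x - y) powr (CARD('n) + \<delta>)) \<partial>lebesgue) *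
          ennreal_powr (maximal_function w x) (1 / p) \<partial>lebesgue)" (is "_ \<le> nn_integral lebesgue ?G")
      unfolding nn_integral_completion[of lborel ?G]
    proof (rule nn_integral_mono_AE)
      show "AE x in lborel. kernel_energy \<delta> (hcube a l) u' x * ennreal_powr (dyadic_maximal a l ?\<omega> x) (1 / p)
          * indicator (hcube a l) x \<le> ?G x"
        using u' Qa
      proof eventually_elim
        case (elim x)
        have Q_eq: "(indicator Q x :: ennreal) = indicator (hcube a l) x"
          using elim by (simp add: indicator_def)
        have "ennreal_powr (dyadic_maximal a l ?\<omega> x) (1 / p) \<le> ennreal_powr (maximal_function w x) (1 / p)"
          using \<open>0 < p\<close> by (intro ennreal_powr_mono dyadic_maximal_le_maximal_function w' l) simp
        then show ?case
          unfolding inner[OF elim(1)] Q_eq by (intro mult_right_mono mult_left_mono) simp_all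
      qed
    qed
    have bound: "ennreal_powr (\<integral>\<^sup>+ x\<in>Q. ennreal (\<bar>u x - m\<bar> powr p * w x) \<partial>lebesgue) (1 / p)
      \<le> ennreal (C * (1 - \<delta>)) *
       (\<integral>\<^sup>+ x\<in>Q.
          (\<integral>\<^sup>+ y\<in>Q. ennreal (\<bar>u x - u y\<bar> / norm (x - y) powr (CARD('n) + \<delta>)) \<partial>lebesgue) *
          ennreal_powr (maximal_function w x) (1 / p) \<partial>lebesgue)"
      unfolding lhs C by (rule order_trans[OF m mult_left_mono[OF rhs]]) simp
    show "(INF k :: real.
       ennreal_powr
         (\<integral>\<^sup>+ x\<in>Q. ennreal (\<bar>u x - k\<bar> powr (CARD('n) / (CARD('n) - \<delta>)) * w x) \<partial>lebesgue)
         ((CARD('n) - \<delta>) / CARD('n)))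
    \<le> ennreal (C * (1 - \<delta>)) *
       (\<integral>\<^sup>+ x\<in>Q.
          (\<integral>\<^sup>+ y\<in>Q. ennreal (\<bar>u x - u y\<bar> / norm (x - y) powr (CARD('n) + \<delta>)) \<partial>lebesgue) *
          ennreal_powr (maximal_function w x) ((CARD('n) - \<delta>) / CARD('n)) \<partial>lebesgue)"
      unfolding s p_def[symmetric]
      by (rule INF_lower2[of m, OF UNIV_I]) (rule bound)
  qed
qed

end
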